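(* Let $\mathfrak g$ be of type $A_n$, let $\lambda=\sum_{i=1}^nm_i\omega_i\in P^+$ and $k=\sum_im_i$. For $1\le q\le k$ let $d(q)\in\{1,\dots,n\}$ be the index such that the $q$-th component of $r_\lambda$ is $\emptyset_{d(q)}$. Then the crystal $\mathcal R(\lambda)$ consists of all sequences $\mathbf x=(x_1,\dots,x_k,0,0,\dots)$ with $x_q\in\bigsqcup_s\mathcal R^{d(q)}_s$ for $1\le q\le k$ such that: 1. for all pairs $(x_q\ne\emptyset_i,\ x_{q+1}\ne\emptyset_j)$, $1\le q\le k-1$, say $x_q=(i_1,i_1')\cdots(i_s,i_s')\in\mathcal R^i_s$ and $x_{q+1}=(j_1,j_1')\cdots(j_t,j_t')\in\mathcal R^j_t$, we have - i) $\sharp\{i_r\mid 1\le i_r\le j_{t-p}\}\ge p+1$ for all $0\le p\le u:=\max\{0\le r\le t-1\mid j_{t-r}\le i\}$; - ii) $j_{t-p}\le i'_{j_{t-p}-p+s-i}$ for all $p\in\{u+1\le r\le t-1\mid j_{t-r}\le r+i\}$; - iii) $j_p'\le i'_{j-i+s-t+p}$ for all $1\le p\le i-j+t$; 2. there is no pair $(x_q,x_{q+1})$, $1\le q\le k-1$, of the form $(\emptyset_i,\ x_{q+1}\ne\emptyset_j)$, with $x_{q+1}=(j_1,j_1')\cdots(j_t,j_t')\in\mathcal R^j_t$ and $i\ge j_t$. (If the set defining $u$ is empty, put $u=-1$.)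
   Context: **Lie algebra.** $\mathfrak g=\mathfrak{sl}_{n+1}$ (type $A_n$), $I=\{1,\dots,n\}$, with simple roots $\alpha_l$, fundamental weights $\omega_l$, $P^+=\bigoplus_i\mathbb Z_{\ge0}\omega_i$. Put $\alpha_{i,j}=\alpha_i+\alpha_{i+1}+\dots+\alpha_j$ for $1\le i\le j\le n$. **Sequences.** For $1\le i\le n$, $s\ge0$, $\mathcal R^i_s$ is the set of sequences $(i_1,i_1')\cdots(i_s,i_s')$ of pairs of integers such that $1\le i_s<i_{s-1}<\dots<i_1\le i\le i_1'<i_2'<\dots<i_s'\le n$. $\emptyset_i$ is the unique element of $\mathcal R^i_0$. Elements of $\mathcal R^i_s$ for different $i$ are regarded as distinct. $\mathcal R=\bigsqcup_{i,s}\mathcal R^i_s\sqcup\{0\}$, and $\mathcal R^\infty$ is the set of infinite sequences $\mathbf x=(x_1,x_2,\dots)$ with $x_j\in\mathcal R$ and only finitely many $x_j\ne0$ (each $\emptyset_i$ counts as non-zero; the component symbol $0$ is not the crystal symbol $0$). **Properties (type $A_n$).** (The paper's definition covers types $A_n$ and $C_n$; in type $A_n$ all conditions involving barred letters disappear, leaving the following.) Let $x=(i_1,i_1')\cdots(i_s,i_s')\in\mathcal R^i_s$, $X=\{i_1,\dots,i_s\}$, $X'=\{i_1',\dots,i_s'\}$, $l\in I$. - (a): $l\notin X\cup X'$; and [$l+1\in X$ if $l<i$; $l-1\in X'$ if $l>i$; no condition if $l=i$]. - (c): $l\in X\cup X'$; and [$l+1\notin X$ if $l<i$; $l-1\notin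 X'$ if $l>i$; $(i_1,i_1')=(l,l)$ if $l=i$]. **Maps $\theta_l,\rho_l$.** For $x\in\mathcal R^i_s$: if $x$ satisfies (a), $\theta_l(x)$ arises from $x$ by replacing $l+1$ by $l$ among the $i_k$ (if $l<i$), replacing $l-1$ by $l$ among the $i_k'$ (if $l>i$), adding the pair $(l,l)$ (if $l=i$); otherwise $\theta_l(x)=0$. If $x$ satisfies (c), $\rho_l(x)$ arises by replacing $l$ by $l+1$ among the $i_k$ (if $l<i$), $l$ by $l-1$ among the $i_k'$ (if $l>i$), erasing $(l,l)$ (if $l=i$); otherwise $\rho_l(x)=0$. The results have the same superscript $i$. **Crystal structure on $\mathcal R^\infty$.** Let $x_{q_1},\dots,x_{q_k}$ ($q_1<\dots<q_k$) be the non-zero components of $\mathbf x$. Put $\mathrm{wt}(\mathbf x)=\sum_{i=1}^nc_i\omega_i-\sum_j\mathrm{wt}(x_j)$, with $c_i$ the number of components in $\bigsqcup_s\mathcal R^i_s$, $\mathrm{wt}((i_1,i_1')\cdots(i_s,i_s'))=\sum_{r}\alpha_{i_r,i_r'}$, $\mathrm{wt}(0)=\mathrm{wt}(\emptyset_i)=0$. Put $\sigma_l^1=\tau_l^1=0$; for $2\le j\le k+1$, $\sigma_l^j(\mathbf x)=\sharp\{1\le p\le j-1: x_{q_p}\text{ satisfies (a)}\}$; for $2\le j\le k$, $\tau_l^j(\mathbf x)=\sharp\{2\le p\le j:x_{q_p}\text{ satisfies (c)}\}$. Let $\mu_l=\min_{1\le j\le k}(\sigma_l^j(\mathbf x)-\tau_l^j(\mathbf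 x))$, and let $f_l(\mathbf x)$ (resp. $e_l(\mathbf x)$) be the largest (resp. smallest) $p\in\{1,\dots,k\}$ with $\sigma_l^p(\mathbf x)-\tau_l^p(\mathbf x)=\mu_l$. Then $\tilde f_l\mathbf x$ is obtained by replacing the component $x_{q_p}$, $p=f_l(\mathbf x)$, by $\theta_l(x_{q_p})$ if this is $\ne0$, and $\tilde f_l\mathbf x=0$ otherwise; $\tilde e_l\mathbf x$ is obtained by replacing $x_{q_p}$, $p=e_l(\mathbf x)$, by $\rho_l(x_{q_p})$ if this is $\neq0$, and $\tilde e_l\mathbf x=0$ otherwise. Finally $\epsilon_l(\mathbf x)=\tau_l^2((\emptyset_1,x_{q_1},0,0,\dots))-\mu_l$ and $\varphi_l(\mathbf x)=\sigma_l^{k+1}(\mathbf x)-\tau_l^k(\mathbf x)-\mu_l$. For $\mathbf x=(0,0,\dots)$ put $\tilde e_l\mathbf x=\tilde f_l\mathbf x=0$, $\epsilon_l(\mathbf x)=\varphi_l(\mathbf x)=0$. **$\mathcal R(\lambda)$.** For $\lambda=\sum_im_i\omega_i\in P^+$, $r_\lambda=(\emptyset_1,\dots,\emptyset_1,\dots,\emptyset_n,\dots,\emptyset_n,0,0,\dots)$ with $\emptyset_i$ occurring $m_i$ times, and $\mathcal R(\lambda)$ is the connected component of $\mathcal R^\infty$ containing $r_\lambda$ (in the graph with arrows $\mathbf x\to\tilde f_l\mathbf x$). *)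

theory Defs
  imports Main
begin

text \<open>
  A pair \<open>(i, [(i\<^sub>1, i\<^sub>1'), \<dots>, (i\<^sub>s, i\<^sub>s')])\<close> stands for an element of \<open>\<R>\<^sup>i\<^sub>s\<close>; the first component
  keeps elements with different superscripts distinct.  In particular \<open>(i, [])\<close> is \<open>\<emptyset>\<^sub>i\<close>.
\<close>

type_synonym rseq = "nat \<times> (nat \<times> nat) list"

definition R :: "nat \<Rightarrow> nat \<Rightarrow> nat \<Rightarrow> rseq set" where
  "R n i s = {(i, xs) | xs. length xs = s
     \<and> sorted_wrt (\<lambda>a b. fst b < fst a \<and> snd a < snd b) xs
     \<and> (\<forall>(a, a') \<in> set xs. 1 \<le> a \<and> a \<le> i \<and> i \<le> a' \<and> a' \<le> n)}"

text \<open>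
  Infinite sequences are functions on \<open>nat\<close>, so that \<open>x q\<close> is the component with number \<open>q + 1\<close>.
  The component symbol \<open>0\<close> is \<open>None\<close>.
\<close>

definition R_inf :: "nat \<Rightarrow> (nat \<Rightarrow> rseq option) set" where
  "R_inf n = {x. finite {q. x q \<noteq> None}
     \<and> (\<forall>q y. x q = Some y \<longrightarrow> (\<exists>i\<in>{1..n}. \<exists>s. y \<in> R n i s))}"

definition prop_a :: "nat \<Rightarrow> rseq \<Rightarrow> bool" where
  "prop_a l = (\<lambda>(i, xs). l \<notin> fst ` set xs \<union> snd ` set xs
     \<and> (l < i \<longrightarrow> l + 1 \<in> fst ` set xs)
     \<and> (l > i \<longrightarrow> l - 1 \<in> snd ` set xs))"

definition prop_c :: "nat \<Rightarrow> rseq \<Rightarrow> bool" where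
  "prop_c l = (\<lambda>(i, xs). l \<in> fst ` set xs \<union> snd ` set xs
     \<and> (l < i \<longrightarrow> l + 1 \<notin> fst ` set xs)
     \<and> (l > i \<longrightarrow> l - 1 \<notin> snd ` set xs)
     \<and> (l = i \<longrightarrow> xs \<noteq> [] \<and> hd xs = (l, l)))"

text \<open>
  The value \<open>0\<close> of \<open>\<theta>\<^sub>l\<close> is \<open>None\<close>.  For \<open>l = i\<close> the new pair \<open>(l, l)\<close> is the innermost one, hence
  it becomes the first entry of the list.
\<close>

definition theta :: "nat \<Rightarrow> rseq \<Rightarrow> rseq option" where
  "theta l = (\<lambda>(i, xs).
     if \<not> prop_a l (i, xs) then None
     else if l < i then Some (i, map (\<lambda>(a, a'). (if a = l + 1 then l else a, a')) xs)
     else if l > i then Some (i, map (\<lambda>(a, a'). (a, if a' = l - 1 then l else a')) xs)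
     else Some (i, (l, l) # xs))"

definition num_nz :: "(nat \<Rightarrow> rseq option) \<Rightarrow> nat" where
  "num_nz x = card {q. x q \<noteq> None}"

text \<open>The position \<open>q\<^sub>p\<close> of the \<open>p\<close>-th non-zero component, for \<open>1 \<le> p \<le> num_nz x\<close>.\<close>

definition nz_pos :: "(nat \<Rightarrow> rseq option) \<Rightarrow> nat \<Rightarrow> nat" where
  "nz_pos x p = sorted_list_of_set {q. x q \<noteq> None} ! (p - 1)"

definition sigma :: "nat \<Rightarrow> (nat \<Rightarrow> rseq option) \<Rightarrow> nat \<Rightarrow> int" where
  "sigma l x j = int (card {p. 1 \<le> p \<and> p \<le> j - 1 \<and> prop_a l (the (x (nz_pos x p)))})"

definition tau :: "nat \<Rightarrow> (nat \<Rightarrow> rseq option) \<Rightarrow> nat \<Rightarrow> int" where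
  "tau l x j = int (card {p. 2 \<le> p \<and> p \<le> j \<and> prop_c l (the (x (nz_pos x p)))})"

definition mu :: "nat \<Rightarrow> (nat \<Rightarrow> rseq option) \<Rightarrow> int" where
  "mu l x = Min ((\<lambda>j. sigma l x j - tau l x j) ` {1..num_nz x})"

definition f_index :: "nat \<Rightarrow> (nat \<Rightarrow> rseq option) \<Rightarrow> nat" where
  "f_index l x = Max {p \<in> {1..num_nz x}. sigma l x p - tau l x p = mu l x}"

text \<open>The Kashiwara operator \<open>f\<^sub>l\<close>; here \<open>None\<close> is the crystal symbol \<open>0\<close>.\<close>

definition f_op :: "nat \<Rightarrow> (nat \<Rightarrow> rseq option) \<Rightarrow> (nat \<Rightarrow> rseq option) option" where
  "f_op l x =
     (if num_nz x = 0 then None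
      else let q = nz_pos x (f_index l x) in
        case theta l (the (x q)) of None \<Rightarrow> None | Some y \<Rightarrow> Some (x(q := Some y)))"

definition arrows :: "nat \<Rightarrow> ((nat \<Rightarrow> rseq option) \<times> (nat \<Rightarrow> rseq option)) set" where
  "arrows n = {(x, y). x \<in> R_inf n \<and> (\<exists>l\<in>{1..n}. f_op l x = Some y)}"

text \<open>
  A dominant weight \<open>\<lambda> = \<Sum>\<^sub>i m\<^sub>i \<omega>\<^sub>i\<close> is given by its coefficients; only \<open>m 1, \<dots>, m n\<close> are used.
\<close>

definition r_weight :: "nat \<Rightarrow> (nat \<Rightarrow> nat) \<Rightarrow> nat \<Rightarrow> rseq option" where
  "r_weight n m =
     (let es = concat (map (\<lambda>i. replicate (m i) (i, [])) [1..<n + 1])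
      in (\<lambda>q. if q < length es then Some (es ! q) else None))"

definition R_crystal :: "nat \<Rightarrow> (nat \<Rightarrow> nat) \<Rightarrow> (nat \<Rightarrow> rseq option) set" where
  "R_crystal n m = {x. (r_weight n m, x) \<in> (arrows n \<union> (arrows n)\<inverse>)\<^sup>*}"

text \<open>
  The entries \<open>i\<^sub>r\<close> and \<open>i\<^sub>r'\<close>, for \<open>1 \<le> r \<le> s\<close>, of a sequence of length \<open>s\<close>.  The subscript is
  an integer because differences of indices occur as subscripts below.
\<close>

definition lo :: "(nat \<times> nat) list \<Rightarrow> int \<Rightarrow> int" where
  "lo xs r = int (fst (xs ! nat (r - 1)))"

definition hi :: "(nat \<times> nat) list \<Rightarrow> int \<Rightarrow> int" where
  "hi xs r = int (snd (xs ! nat (r - 1)))"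

definition u_bound :: "nat \<Rightarrow> (nat \<times> nat) list \<Rightarrow> int" where
  "u_bound i ys =
     (let t = int (length ys); U = {r. 0 \<le> r \<and> r \<le> t - 1 \<and> lo ys (t - r) \<le> int i}
      in if U = {} then -1 else Max U)"

text \<open>
  Conditions i), ii), iii) on \<open>(i, xs)\<close> followed by \<open>(j, ys)\<close>.  For \<open>i \<le> j\<close> and elements of
  \<open>\<R>\<^sup>i\<^sub>s\<close>, \<open>\<R>\<^sup>j\<^sub>t\<close>, condition i) forces every subscript of \<open>hi xs\<close> in ii) and iii) to lie
  in \<open>{1..s}\<close>, so out-of-range values of \<open>lo\<close> and \<open>hi\<close> do not matter.
\<close>

definition cond_i :: "rseq \<Rightarrow> rseq \<Rightarrow> bool" where
  "cond_i = (\<lambda>(i, xs) (j, ys). let t = int (length ys) in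
     \<forall>p. 0 \<le> p \<and> p \<le> u_bound i ys \<longrightarrow>
       int (card {a \<in> fst ` set xs. 1 \<le> a \<and> int a \<le> lo ys (t - p)}) \<ge> p + 1)"

definition cond_ii :: "rseq \<Rightarrow> rseq \<Rightarrow> bool" where
  "cond_ii = (\<lambda>(i, xs) (j, ys). let s = int (length xs); t = int (length ys) in
     \<forall>p. u_bound i ys + 1 \<le> p \<and> p \<le> t - 1 \<and> lo ys (t - p) \<le> p + int i \<longrightarrow>
       lo ys (t - p) \<le> hi xs (lo ys (t - p) - p + s - int i))"

definition cond_iii :: "rseq \<Rightarrow> rseq \<Rightarrow> bool" where
  "cond_iii = (\<lambda>(i, xs) (j, ys). let s = int (length xs); t = int (length ys) in
     \<forall>p. 1 \<le> p \<and> p \<le> int i - int j + t \<longrightarrow>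
       hi ys p \<le> hi xs (int j - int i + s - t + p))"

end

theory Submission
  imports Defs
begin

text \<open>
  An element of \<open>\<R>\<^sup>i\<^sub>s\<close> encodes a subset of \<open>{1..n+1}\<close> with \<open>i\<close> elements, the column obtained from
  \<open>{1..i}\<close> by removing the entries \<open>i\<^sub>r\<close> and adding the numbers \<open>i\<^sub>r' + 1\<close>. In these terms (a) means
  that \<open>l\<close> but not \<open>l + 1\<close> lies in the column, (c) that \<open>l + 1\<close> but not \<open>l\<close> does, and \<open>\<theta>\<^sub>l\<close> replaces \<open>l\<close> by
  \<open>l + 1\<close> (\<open>prop_a_iff\<close>, \<open>prop_c_iff\<close>, \<open>theta_Some\<close>). The operators \<open>f\<^sub>l\<close> follow the usual signature
  rule, so \<open>\<R>(\<lambda>)\<close> is the crystal of semistandard tableaux, with the columns listed from the shortest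
  to the longest.

  Two columns \<open>C\<close>, \<open>D\<close> of lengths \<open>i \<le> j\<close> may be neighbours in such a tableau if and only if, for all
  \<open>v\<close>, at most as many elements of \<open>C\<close> as of \<open>D\<close> are \<open>\<le> v\<close>. Expressed by the entries of the sequences,
  this inequality is i) for \<open>v \<le> i\<close>, ii) for \<open>i < v \<le> j\<close> and iii) for \<open>v \<ge> j\<close>, and condition 2 if the
  first sequence is empty (\<open>adjacent_iff\<close>).

  The semistandard sequences are stable under \<open>f\<^sub>l\<close> and under taking preimages
  (\<open>semistandard_f_op\<close>, \<open>semistandard_f_op_inverse\<close>): a single replacement could only violate the
  inequality at \<open>v = l\<close> and in case of equality there, but then the neighbouring column would have
  (a) or (c) as well and the signature rule would have selected another position. Conversely, a
  semistandard sequence other than \<open>r\<^sub>\<lambda>\<close> is \<open>f\<^sub>l x\<close> for some \<open>l\<close> and some semistandard \<open>x\<close> with a smaller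
  sum of entries (\<open>semistandard_raise\<close>), so by induction it is connected to \<open>r\<^sub>\<lambda>\<close>.
\<close>

section \<open>Counting the entries of a sequence\<close>

text \<open>
  The \<open>r\<close>-th smallest element of a finite set lies below \<open>v\<close> exactly if more than \<open>r\<close> elements do
  (counting from \<open>0\<close>). This turns statements about entries into statements about counting
  functions.
\<close>

lemma nth_less_iff_card:
  fixes xs :: "nat list"
  assumes "sorted_wrt (<) xs" "r < length xs"
  shows "xs ! r < v \<longleftrightarrow> r < card {a \<in> set xs. a < v}"
  using assms
proof (induction xs arbitrary: r)
  case (Cons a xs)
  show ?case
  proof (cases "a < v")
    case True
    have "{b \<in> set (a # xs). b < v} = insert a {b \<in> set xs. b < v}" using True by auto
    moreover have "a \<notin> {b \<in> set xs. b < v}" using Cons.prems by auto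
    ultimately have c: "card {b \<in> set (a # xs). b < v} = Suc (card {b \<in> set xs. b < v})" by simp
    show ?thesis
    proof (cases r)
      case 0 then show ?thesis using c True by simp
    next
      case (Suc r') then show ?thesis using c Cons by simp
    qed
  next
    case False
    have e: "{b \<in> set (a # xs). b < v} = {}" using False Cons.prems by auto
    have "\<not> (a # xs) ! r < v" using Cons.prems nth_mem[of r "a # xs"] e by blast
    then show ?thesis unfolding e by simp
  qed
qed simp

text \<open>
  For an element \<open>x\<close> of \<open>\<R>\<^sup>i\<^sub>s\<close>, \<open>lows x v\<close> is the number of entries \<open>i\<^sub>r \<le> v\<close>, and \<open>highs x v\<close> the number of entries
  \<open>i\<^sub>r' < v\<close>. The second inequality is strict because the entry \<open>i\<^sub>r'\<close> contributes \<open>i\<^sub>r' + 1\<close> to the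
  column defined below.
\<close>

definition lows :: "rseq \<Rightarrow> nat \<Rightarrow> nat" where
  "lows x v = card {a \<in> fst ` set (snd x). a \<le> v}"

definition highs :: "rseq \<Rightarrow> nat \<Rightarrow> nat" where
  "highs x v = card {a \<in> snd ` set (snd x). a < v}"

lemma R_D:
  assumes "(i, xs) \<in> R n j s"
  shows "i = j" "length xs = s" "sorted_wrt (\<lambda>a b. fst b < fst a \<and> snd a < snd b) xs"
    "\<And>a. a \<in> fst ` set xs \<Longrightarrow> 1 \<le> a \<and> a \<le> i"
    "\<And>a. a \<in> snd ` set xs \<Longrightarrow> i \<le> a \<and> a \<le> n"
    "card (fst ` set xs) = s" "card (snd ` set xs) = s"
    "sorted_wrt (>) (map fst xs)" "sorted_wrt (<) (map snd xs)"
proof -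
  show a: "i = j" "length xs = s" and
    srt: "sorted_wrt (\<lambda>a b. fst b < fst a \<and> snd a < snd b) xs" using assms by (auto simp: R_def)
  show "\<And>a. a \<in> fst ` set xs \<Longrightarrow> 1 \<le> a \<and> a \<le> i"
    "\<And>a. a \<in> snd ` set xs \<Longrightarrow> i \<le> a \<and> a \<le> n" using assms by (fastforce simp: R_def)+
  show f: "sorted_wrt (>) (map fst xs)" and g: "sorted_wrt (<) (map snd xs)"
    using srt by (auto simp: sorted_wrt_map elim: sorted_wrt_mono_rel[rotated])
  have "distinct (rev (map fst xs))" using f
    by (metis sorted_wrt_rev strict_sorted_iff rev_rev_ident)
  then show "card (fst ` set xs) = s" using a(2) distinct_card by fastforce
  have "distinct (map snd xs)" using g strict_sorted_iff by blast
  then show "card (snd ` set xs) = s" using a(2) distinct_card by fastforce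
qed

lemma lo_le_iff:
  assumes "(j, ys) \<in> R n j' t" "p < t"
  shows "lo ys (int t - int p) \<le> int v \<longleftrightarrow> p < lows (j, ys) v"
proof -
  note D = R_D[OF assms(1)]
  have "sorted_wrt (<) (rev (map fst ys))" using D(8) by (simp add: sorted_wrt_rev)
  from nth_less_iff_card[OF this, of p "Suc v"]
  have "rev (map fst ys) ! p < Suc v \<longleftrightarrow> p < card {a \<in> fst ` set ys. a < Suc v}"
    using D(2) assms(2) by simp
  moreover have "rev (map fst ys) ! p = fst (ys ! (t - Suc p))"
    using D(2) assms(2) by (simp add: rev_nth)
  moreover have "nat (int t - int p - 1) = t - Suc p" using assms(2) by linarith
  ultimately show ?thesis by (simp add: lo_def lows_def less_Suc_eq_le)
qed

lemma hi_less_iff: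
  assumes "(j, ys) \<in> R n j' t" "1 \<le> p" "p \<le> int t"
  shows "hi ys p < int v \<longleftrightarrow> p \<le> int (highs (j, ys) v)"
proof -
  note D = R_D[OF assms(1)]
  have "nat (p - 1) < length (map snd ys)" using D(2) assms by simp
  from nth_less_iff_card[OF D(9) this, of v]
  have "snd (ys ! nat (p - 1)) < v \<longleftrightarrow> nat (p - 1) < card {a \<in> snd ` set ys. a < v}"
    using D(2) assms by (simp)
  then show ?thesis using assms(2) by (auto simp add: hi_def highs_def)
qed

lemma lows_mono: "v \<le> w \<Longrightarrow> lows x v \<le> lows x w"
  unfolding lows_def by (rule card_mono) auto

lemma lows_le:
  assumes "(i, xs) \<in> R n i' s" shows "lows (i, xs) v \<le> s"
  unfolding lows_def snd_conv R_D(6)[OF assms, symmetric] by (rule card_mono) auto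

lemma lows_eq:
  assumes "(i, xs) \<in> R n i' s" "i \<le> v" shows "lows (i, xs) v = s"
proof -
  have "{a \<in> fst ` set xs. a \<le> v} = fst ` set xs" using R_D(4)[OF assms(1)] assms(2) by fastforce
  then show ?thesis using R_D(6)[OF assms(1)] by (simp add: lows_def)
qed

lemma highs_le:
  assumes "(i, xs) \<in> R n i' s" shows "highs (i, xs) v \<le> s"
  unfolding highs_def snd_conv R_D(7)[OF assms, symmetric] by (rule card_mono) auto

lemma highs_zero:
  assumes "(i, xs) \<in> R n i' s" "v \<le> i" shows "highs (i, xs) v = 0"
proof -
  have "{a \<in> snd ` set xs. a < v} = {}" using R_D(5)[OF assms(1)] assms(2) by fastforce
  then show ?thesis unfolding highs_def snd_conv by (simp only: card.empty)
qed

lemma highs_step: "w \<le> v \<Longrightarrow> highs x v \<le> highs x w + (v - w)"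
proof -
  assume "w \<le> v"
  have "{a \<in> snd ` set (snd x). a < v} \<subseteq> {a \<in> snd ` set (snd x). a < w} \<union> {w..<v}" by auto
  then have "highs x v \<le> card ({a \<in> snd ` set (snd x). a < w} \<union> {w..<v})"
    unfolding highs_def by (intro card_mono) auto
  also have "\<dots> \<le> card {a \<in> snd ` set (snd x). a < w} + card {w..<v}" by (rule card_Un_le)
  finally show ?thesis by (simp add: highs_def)
qed

text \<open>
  The entries \<open>j\<^sub>t < j\<^bsub>t-1\<^esub> < \<dots>\<close> that are at most \<open>i\<close> form an initial segment of this list, so the
  bound \<open>u\<close> is one less than their number; this includes the value \<open>-1\<close> if there are none.
\<close>

lemma u_bound_eq:
  assumes "(j, ys) \<in> R n j' t"
  shows "u_bound i ys = int (lows (j, ys) i) - 1"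
proof -
  define b where "b = lows (j, ys) i"
  have len: "length ys = t" using R_D(2)[OF assms] .
  have bt: "b \<le> t" unfolding b_def using lows_le[OF assms] .
  have U: "{r. 0 \<le> r \<and> r \<le> int t - 1 \<and> lo ys (int t - r) \<le> int i} = {0..int b - 1}" (is "?U = _")
  proof -
    have "r \<in> ?U \<longleftrightarrow> r \<in> {0..int b - 1}" for r
    proof (cases "0 \<le> r \<and> r < int t")
      case True
      then obtain p where p: "r = int p" "p < t" by (metis nat_0_le nat_less_iff)
      show ?thesis using lo_le_iff[OF assms p(2), of i] p by (auto simp: b_def)
    next
      case False then show ?thesis using bt by auto
    qed
    then show ?thesis by blast
  qed
  show ?thesis
  proof (cases "b = 0")
    case True
    then show ?thesis unfolding u_bound_def Let_def len U b_def[symmetric] by simp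
  next
    case False
    then have "Max {0..int b - 1} = int b - 1" by (intro Max_eqI) auto
    then show ?thesis unfolding u_bound_def Let_def len U b_def[symmetric] using False by auto
  qed
qed

section \<open>Columns and the comparison conditions\<close>

text \<open>
  The column of an element of \<open>\<R>\<^sup>i\<^sub>s\<close>: the subset of \<open>{1..n+1}\<close> of size \<open>i\<close> that arises from
  \<open>{1..i}\<close> by removing all \<open>i\<^sub>r\<close> and adding all \<open>i\<^sub>r' + 1\<close>.
\<close>

definition column :: "rseq \<Rightarrow> nat set" where
  "column = (\<lambda>(i, xs). ({1..i} - fst ` set xs) \<union> Suc ` snd ` set xs)"

text \<open>
  The counting function of a set. For sorted columns of lengths \<open>i \<le> j\<close>, the inequality
  \<open>count C \<le> count D\<close> says that the \<open>r\<close>-th entry of \<open>D\<close> is at most that of \<open>C\<close> for all \<open>r \<le> i\<close>.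
\<close>

definition count :: "nat set \<Rightarrow> nat \<Rightarrow> nat" where
  "count C v = card (C \<inter> {..v})"

lemma count_column:
  assumes "(i, xs) \<in> R n i' s"
  shows "int (count (column (i, xs)) v) = int (min v i) - int (lows (i, xs) v) + int (highs (i, xs) v)"
proof -
  note D = R_D[OF assms]
  let ?X = "{a \<in> fst ` set xs. a \<le> v}" and ?Y = "{a \<in> snd ` set xs. a < v}"
  have e: "column (i, xs) \<inter> {..v} = ({1..min v i} - ?X) \<union> Suc ` ?Y"
    by (auto simp: column_def)
  have "({1..min v i} - ?X) \<inter> Suc ` ?Y = {}" using D(5) by fastforce
  then have "count (column (i, xs)) v = card ({1..min v i} - ?X) + card (Suc ` ?Y)"
    unfolding count_def e by (subst card_Un_disjoint) auto
  moreover have sub: "?X \<subseteq> {1..min v i}" using D(4) by fastforce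
  moreover have "card ({1..min v i} - ?X) = card {1..min v i} - card ?X"
    by (rule card_Diff_subset) (use sub in auto)
  moreover have "card ?X \<le> card {1..min v i}" by (rule card_mono) (use sub in auto)
  moreover have "card (Suc ` ?Y) = card ?Y" by (rule card_image) auto
  moreover have "card {1..min v i} = min v i" by simp
  ultimately show ?thesis unfolding lows_def highs_def snd_conv by linarith
qed

lemma finite_column: "finite (column x)"
  by (cases x) (auto simp: column_def)

lemma cond_i_iff:
  assumes x: "(i, xs) \<in> R n i s" and y: "(j, ys) \<in> R n j t"
  shows "cond_i (i, xs) (j, ys) \<longleftrightarrow> (\<forall>v\<le>i. lows (j, ys) v \<le> lows (i, xs) v)"
proof -
  have len: "length ys = t" using R_D(2)[OF y] .
  let ?L = "\<lambda>p. lo ys (int t - p)"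
  have eq: "card {a \<in> fst ` set xs. 1 \<le> a \<and> int a \<le> ?L p} = lows (i, xs) (nat (?L p))" for p
  proof -
    have "{a \<in> fst ` set xs. 1 \<le> a \<and> int a \<le> ?L p} = {a \<in> fst ` set xs. a \<le> nat (?L p)}"
      using R_D(4)[OF x] by (fastforce simp: lo_def)
    then show ?thesis by (simp add: lows_def)
  qed
  have pos: "int (nat (?L p)) = ?L p" for p by (simp add: lo_def)
  show ?thesis
  proof
    assume "cond_i (i, xs) (j, ys)"
    then have c: "int (lows (i, xs) (nat (?L p))) \<ge> p + 1"
      if "0 \<le> p" "p < int (lows (j, ys) i)" for p
      using that unfolding cond_i_def prod.case Let_def len eq u_bound_eq[OF y] by simp
    show "\<forall>v\<le>i. lows (j, ys) v \<le> lows (i, xs) v"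
    proof (intro allI impI)
      fix v assume v: "v \<le> i"
      show "lows (j, ys) v \<le> lows (i, xs) v"
      proof (cases "lows (j, ys) v")
        case (Suc p)
        have pt: "p < t" using Suc lows_le[OF y, of v] by simp
        have "?L (int p) \<le> int v" using lo_le_iff[OF y pt, of v] Suc by simp
        then have "nat (?L (int p)) \<le> v" by simp
        then have "lows (i, xs) (nat (?L (int p))) \<le> lows (i, xs) v" by (rule lows_mono)
        moreover have "int p < int (lows (j, ys) i)" using lows_mono[OF v, of "(j, ys)"] Suc by simp
        ultimately show ?thesis using c[of "int p"] Suc by simp
      qed simp
    qed
  next
    assume h: "\<forall>v\<le>i. lows (j, ys) v \<le> lows (i, xs) v"
    have "int (lows (i, xs) (nat (?L r))) \<ge> r + 1"
      if r: "0 \<le> r" "r < int (lows (j, ys) i)" for r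
    proof -
      obtain p where p: "r = int p" using r(1) nonneg_int_cases by blast
      have pt: "p < t" using p r lows_le[OF y, of i] by simp
      have "?L r \<le> int i" using lo_le_iff[OF y pt, of i] r p by simp
      moreover have "p < lows (j, ys) (nat (?L r))"
        using lo_le_iff[OF y pt, of "nat (?L r)"] pos[of r] p by simp
      ultimately show ?thesis using h p
        by (metis (no_types, opaque_lifting) Suc_leI add.commute le_trans nat_int nat_mono of_nat_Suc of_nat_le_iff)
    qed
    then show "cond_i (i, xs) (j, ys)"
      unfolding cond_i_def prod.case Let_def len eq u_bound_eq[OF y] by simp
  qed
qed

text \<open>
  By \<open>count_column\<close>, the inequality of counting functions takes a different form on each of the
  ranges \<open>v \<le> i\<close>, \<open>i < v \<le> j\<close> and \<open>j \<le> v\<close>. On the first one it is condition i). Given i), it is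
  condition ii) on the second and condition iii) on the third. The conditions test the inequality
  only at entries of the second sequence; i) and the monotonicity of the counting functions
  extend it to all \<open>v\<close>.
\<close>

lemma conditions_iff:
  assumes x: "(i, xs) \<in> R n i s" and y: "(j, ys) \<in> R n j t" and ij: "i \<le> j"
  shows "cond_i (i, xs) (j, ys) \<and> cond_ii (i, xs) (j, ys) \<and> cond_iii (i, xs) (j, ys) \<longleftrightarrow>
    (\<forall>v. count (column (i, xs)) v \<le> count (column (j, ys)) v)" (is "?L \<longleftrightarrow> ?R")
proof -
  let ?A = "lows (i, xs)" and ?A' = "highs (i, xs)" and ?B = "lows (j, ys)" and ?B' = "highs (j, ys)"
  have lx: "length xs = s" and ly: "length ys = t" using R_D(2) x y by auto
  have cnt: "count (column (i, xs)) v \<le> count (column (j, ys)) v \<longleftrightarrow>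
     int (min v i) - int (?A v) + int (?A' v) \<le> int (min v j) - int (?B v) + int (?B' v)" for v
    using count_column[OF x, of v] count_column[OF y, of v] by linarith
  \<comment> \<open>The columns are compared on the three ranges; at \<open>v = j\<close> the last two agree.\<close>
  have mid: "?R \<longleftrightarrow> (\<forall>v\<le>i. ?B v \<le> ?A v)
     \<and> (\<forall>v. i < v \<and> v \<le> j \<longrightarrow> int i - int s + int (?A' v) \<le> int v - int (?B v))
     \<and> (\<forall>v\<ge>j. int i - int s + int (?A' v) \<le> int j - int t + int (?B' v))" (is "_ \<longleftrightarrow> ?P1 \<and> ?P2 \<and> ?P3")
  proof (intro iffI conjI allI impI)
    fix v assume ?R and "v \<le> i"
    then show "?B v \<le> ?A v" using cnt[of v] highs_zero[OF x, of v] highs_zero[OF y, of v] ij by simp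
  next
    fix v assume ?R and "i < v \<and> v \<le> j"
    then show "int i - int s + int (?A' v) \<le> int v - int (?B v)"
      using cnt[of v] lows_eq[OF x, of v] highs_zero[OF y, of v] by simp
  next
    fix v assume ?R and "j \<le> v"
    then show "int i - int s + int (?A' v) \<le> int j - int t + int (?B' v)"
      using cnt[of v] lows_eq[OF x, of v] lows_eq[OF y, of v] ij by simp
  next
    fix v assume h: "?P1 \<and> ?P2 \<and> ?P3"
    consider "v \<le> i" | "i < v" "v \<le> j" | "j \<le> v" by linarith
    then show "count (column (i, xs)) v \<le> count (column (j, ys)) v"
    proof cases
      case 1
      then show ?thesis unfolding cnt
        using h highs_zero[OF x, of v] highs_zero[OF y, of v] ij by simp
    next
      case 2
      then show ?thesis unfolding cnt
        using h lows_eq[OF x, of v] highs_zero[OF y, of v] by simp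
    next
      case 3
      then show ?thesis unfolding cnt
        using h lows_eq[OF x, of v] lows_eq[OF y, of v] ij by simp
    qed
  qed
  have ii: "cond_ii (i, xs) (j, ys) \<longleftrightarrow> ?P2" if P1: ?P1
  proof -
    have Bi: "?B i \<le> s" using P1 lows_eq[OF x, of i] by auto
    have c2: "cond_ii (i, xs) (j, ys) \<longleftrightarrow> (\<forall>p<t. ?B i \<le> p \<and> lo ys (int t - int p) \<le> int p + int i \<longrightarrow>
      lo ys (int t - int p) \<le> hi xs (lo ys (int t - int p) - int p + int s - int i))" (is "_ \<longleftrightarrow> ?Q")
    proof
      assume c: "cond_ii (i, xs) (j, ys)"
      show ?Q
      proof (intro allI impI)
        fix p assume "p < t" "?B i \<le> p \<and> lo ys (int t - int p) \<le> int p + int i"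
        then show "lo ys (int t - int p) \<le> hi xs (lo ys (int t - int p) - int p + int s - int i)"
          using c[unfolded cond_ii_def] by (simp add: Let_def lx ly u_bound_eq[OF y])
      qed
    next
      assume q: ?Q
      show "cond_ii (i, xs) (j, ys)" unfolding cond_ii_def prod.case Let_def lx ly u_bound_eq[OF y]
      proof (intro allI impI)
        fix r assume r: "int (?B i) - 1 + 1 \<le> r \<and> r \<le> int t - 1 \<and> lo ys (int t - r) \<le> r + int i"
        then obtain p where "r = int p" using nonneg_int_cases[of r] by auto
        then show "lo ys (int t - r) \<le> hi xs (lo ys (int t - r) - r + int s - int i)"
          using q r by simp
      qed
    qed
    have one: "(lo ys (int t - int p) \<le> hi xs (lo ys (int t - int p) - int p + int s - int i)) \<longleftrightarrow>
        int (?A' w) < int w - int p + int s - int i"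
      "?B w = Suc p" "i < w" "w \<le> j"
      if p: "p < t" "?B i \<le> p" and w: "lo ys (int t - int p) = int w" and "w \<le> p + i" for p w
    proof -
      \<comment> \<open>The value \<open>w\<close> is the \<open>(p+1)\<close>-st smallest lower entry, and the subscript of \<open>hi xs\<close> is in range.\<close>
      show iw: "i < w" using lo_le_iff[OF y p(1), of i] p(2) w by simp
      show "w \<le> j" using lo_le_iff[OF y p(1), of j] lows_eq[OF y, of j] p(1) w by simp
      have lb: "p < ?B w" using lo_le_iff[OF y p(1), of w] w by simp
      have ub: "\<not> Suc p < ?B w"
      proof
        assume a: "Suc p < ?B w"
        then have "Suc p < t" using lows_le[OF y, of w] by simp
        have e: "nat (int t - int p - 1) = t - Suc p" by linarith
        have "fst (ys ! (t - Suc p)) < fst (ys ! (t - Suc (Suc p)))"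
          using sorted_wrt_nth_less[OF R_D(8)[OF y], of "t - Suc (Suc p)" "t - Suc p"]
            \<open>Suc p < t\<close> ly by simp
        moreover have "fst (ys ! (t - Suc p)) = w" using w p(1)
          by (simp add: lo_def flip: e)
        moreover have "nat (int t - int (Suc p) - 1) = t - Suc (Suc p)" by linarith
        moreover have "lo ys (int t - int (Suc p)) \<le> int w"
          using lo_le_iff[OF y \<open>Suc p < t\<close>, of w] a by simp
        ultimately show False by (simp add: lo_def)
      qed
      show "?B w = Suc p" using lb ub by simp
      have "?B w \<le> ?B i + (w - i)"
      proof -
        have "{a \<in> fst ` set ys. a \<le> w} \<subseteq> {a \<in> fst ` set ys. a \<le> i} \<union> {i<..w}" by auto
        then have "?B w \<le> card ({a \<in> fst ` set ys. a \<le> i} \<union> {i<..w})"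
          unfolding lows_def snd_conv by (intro card_mono) auto
        also have "\<dots> \<le> card {a \<in> fst ` set ys. a \<le> i} + card {i<..w}" by (rule card_Un_le)
        finally show ?thesis by (simp add: lows_def)
      qed
      then have "1 \<le> int w - int p + int s - int i" using lb Bi iw by linarith
      moreover have "int w - int p + int s - int i \<le> int s" using that(4) by linarith
      ultimately have "hi xs (int w - int p + int s - int i) < int w
        \<longleftrightarrow> int w - int p + int s - int i \<le> int (?A' w)"
        by (rule hi_less_iff[OF x])
      then show "(lo ys (int t - int p) \<le> hi xs (lo ys (int t - int p) - int p + int s - int i)) \<longleftrightarrow>
        int (?A' w) < int w - int p + int s - int i" unfolding w by linarith
    qed
    show ?thesis
    proof
      assume c: "cond_ii (i, xs) (j, ys)"
      show ?P2
      proof (intro allI impI)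
        fix v assume v: "i < v \<and> v \<le> j"
        show "int i - int s + int (?A' v) \<le> int v - int (?B v)"
        proof (cases "?B v \<le> ?B i")
          case True
          \<comment> \<open>No lower entry of \<open>ys\<close> lies in \<open>{i<..v}\<close>, and at most \<open>v - i\<close> upper entries of \<open>xs\<close> are below \<open>v\<close>.\<close>
          have "?A' v \<le> v - i" using highs_step[of i v "(i, xs)"] highs_zero[OF x, of i] v by simp
          then show ?thesis using True Bi v by linarith
        next
          case False
          then obtain p where p: "?B v = Suc p" "?B i \<le> p" by (cases "?B v") auto
          have pt: "p < t" using p lows_le[OF y, of v] by simp
          \<comment> \<open>For the largest lower entry \<open>w \<le> v\<close> of \<open>ys\<close> the inequality is ii), or follows from \<open>?A' v \<le> s\<close> if
            \<open>w > p + i\<close>; from \<open>w\<close> to \<open>v\<close> the left side grows at most as fast as the right.\<close>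
          obtain w where w: "lo ys (int t - int p) = int w" by (auto simp: lo_def)
          have wv: "w \<le> v" using lo_le_iff[OF y pt, of v] p w by simp
          show ?thesis
          proof (cases "w \<le> p + i")
            case True
            have "int (?A' w) < int w - int p + int s - int i"
              using one(1)[OF pt p(2) w True] c[unfolded c2] pt p(2) w True by auto
            then show ?thesis using highs_step[OF wv, of "(i, xs)"] p(1) wv by linarith
          next
            case False
            then show ?thesis using highs_le[OF x, of v] p(1) wv by linarith
          qed
        qed
      qed
    next
      assume h: ?P2
      show "cond_ii (i, xs) (j, ys)" unfolding c2
      proof (intro allI impI)
        fix p assume pt: "p < t" and a: "?B i \<le> p \<and> lo ys (int t - int p) \<le> int p + int i"
        obtain w where w: "lo ys (int t - int p) = int w" by (auto simp: lo_def)
        have wp: "w \<le> p + i" using a w by simp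
        note o = one[OF pt _ w wp]
        show "lo ys (int t - int p) \<le> hi xs (lo ys (int t - int p) - int p + int s - int i)"
          using o a h[rule_format, of w] by linarith
      qed
    qed
  qed
  have iii: "cond_iii (i, xs) (j, ys) \<longleftrightarrow> ?P3" if D: "int t - int s \<le> int j - int i"
  proof -
    define d where "d = int j - int i + int s - int t"
    have c3: "cond_iii (i, xs) (j, ys) \<longleftrightarrow>
      (\<forall>p. 1 \<le> p \<and> d + p \<le> int s \<longrightarrow> hi ys p \<le> hi xs (d + p))"
      unfolding cond_iii_def prod.case Let_def lx ly d_def
      by (intro iff_allI imp_cong) (auto simp: algebra_simps)
    have d0: "0 \<le> d" using D by (simp add: d_def)
    show ?thesis
    proof
      assume c: "cond_iii (i, xs) (j, ys)"
      show ?P3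
      proof (intro allI impI)
        fix v assume v: "j \<le> v"
        let ?p = "int (?B' v) + 1"
        have "int (?A' v) \<le> d + int (?B' v)"
        proof (rule ccontr)
          assume a: "\<not> ?thesis"
          then have ps: "d + ?p \<le> int s" using highs_le[OF x, of v] by linarith
          then have pt: "?p \<le> int t" using ij by (simp add: d_def)
          have "\<not> hi ys ?p < int v" using hi_less_iff[OF y _ pt, of v] by simp
          moreover have "hi xs (d + ?p) < int v" using hi_less_iff[OF x _ ps, of v] a d0 by simp
          moreover have "hi ys ?p \<le> hi xs (d + ?p)" using c[unfolded c3, rule_format, of ?p] ps by simp
          ultimately show False by linarith
        qed
        then show "int i - int s + int (?A' v) \<le> int j - int t + int (?B' v)" by (simp add: d_def)
      qed
    next
      assume h: ?P3
      show "cond_iii (i, xs) (j, ys)" unfolding c3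
      proof (intro allI impI)
        fix p assume p: "1 \<le> p \<and> d + p \<le> int s"
        then have pt: "p \<le> int t" using ij by (simp add: d_def)
        obtain v where v: "hi ys p = int v" by (auto simp: hi_def)
        have b: "\<not> p \<le> int (?B' v)" using hi_less_iff[OF y _ pt, of v] p v by simp
        have "snd (ys ! nat (p - 1)) \<in> snd ` set ys" using pt p ly by (intro imageI nth_mem) auto
        then have "j \<le> v" using R_D(5)[OF y] v by (auto simp: hi_def)
        then have "\<not> d + p \<le> int (?A' v)" using h[rule_format, of v] b by (auto simp: d_def)
        then show "hi ys p \<le> hi xs (d + p)" using hi_less_iff[OF x, of "d + p" v] p d0 v by auto
      qed
    qed
  qed
  \<comment> \<open>The number \<open>j - i + s - t\<close> is not negative, so the subscripts of \<open>hi xs\<close> in iii) are positive.\<close>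
  have D: "int t - int s \<le> int j - int i" if ?P1
  proof (cases "i = j")
    case True
    then show ?thesis using that lows_eq[OF x, of i] lows_eq[OF y, of j] by auto
  next
    case False
    have "{a \<in> fst ` set ys. a \<le> j} \<subseteq> {a \<in> fst ` set ys. a \<le> i} \<union> {i<..j}" by auto
    then have "?B j \<le> card ({a \<in> fst ` set ys. a \<le> i} \<union> {i<..j})"
      unfolding lows_def snd_conv by (intro card_mono) auto
    also have "\<dots> \<le> card {a \<in> fst ` set ys. a \<le> i} + card {i<..j}" by (rule card_Un_le)
    finally have "?B j \<le> ?B i + (j - i)" by (simp add: lows_def)
    then show ?thesis using that lows_eq[OF x, of i] lows_eq[OF y, of j] ij by auto
  qed
  show ?thesis unfolding mid using cond_i_iff[OF x y] ii iii D by blast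
qed

lemma count_empty_column:
  assumes y: "(j, ys) \<in> R n j t" and ij: "i \<le> j"
  shows "(\<forall>v. count (column (i, [])) v \<le> count (column (j, ys)) v) \<longleftrightarrow> (\<forall>a\<in>fst ` set ys. i < a)"
    (is "?L \<longleftrightarrow> ?R")
proof
  have x: "(i, []) \<in> R n i 0" by (simp add: R_def)
  note c = count_column[OF x] count_column[OF y]
  have z: "lows (i, []) v = 0" "highs (i, []) v = 0" for v by (auto simp: lows_def highs_def)
  { assume ?L
    then have "count (column (i, [])) i \<le> count (column (j, ys)) i" by blast
    then have "lows (j, ys) i = 0" using c[of i] z[of i] highs_zero[OF y ij] ij by simp
    then have "{a \<in> fst ` set ys. a \<le> i} = {}" by (simp add: lows_def)
    then show ?R by fastforce }
  { assume r: ?R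
    show ?L
    proof
      fix v
      have "{1..min v i} \<subseteq> column (j, ys) \<inter> {..v}" using r ij by (fastforce simp: column_def)
      then have "card {1..min v i} \<le> count (column (j, ys)) v"
        unfolding count_def by (intro card_mono) (auto simp: finite_column)
      then show "count (column (i, [])) v \<le> count (column (j, ys)) v"
        using c(1)[of v] z[of v] by simp
    qed }
qed

lemma count_full_column:
  assumes x: "(i, xs) \<in> R n i s" and ij: "i \<le> j"
  shows "count (column (i, xs)) v \<le> count (column (j, [])) v"
proof -
  have y: "(j, []) \<in> R n j 0" by (simp add: R_def)
  have z: "lows (j, []) v = 0" "highs (j, []) v = 0" for v by (auto simp: lows_def highs_def)
  show ?thesis
  proof (cases "v \<le> i")
    case True
    then show ?thesis using count_column[OF x, of v] count_column[OF y, of v] z highs_zero[OF x, of v] ij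
      by simp
  next
    case False
    then show ?thesis using count_column[OF x, of v] count_column[OF y, of v] z[of v] lows_eq[OF x, of v]
       highs_step[of i v "(i, xs)"] highs_zero[OF x, of i] highs_le[OF x, of v] ij
      by (simp add: min_def split: if_splits)
  qed
qed

section \<open>Lowering an entry of a column\<close>

text \<open>
  The effect of \<open>\<theta>\<^sub>l\<close> on columns: the entry \<open>l\<close> becomes \<open>l + 1\<close>.
\<close>

definition lower :: "nat \<Rightarrow> nat set \<Rightarrow> nat set" where
  "lower l C = insert (Suc l) (C - {l})"

lemma count_Suc:
  assumes "finite C"
  shows "count C (Suc v) = count C v + (if Suc v \<in> C then 1 else 0)"
proof -
  have "C \<inter> {..Suc v} = (if Suc v \<in> C then insert (Suc v) (C \<inter> {..v}) else C \<inter> {..v})"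
    by (auto simp: le_Suc_eq)
  then show ?thesis using assms by (simp add: count_def)
qed

lemma count_lower:
  assumes "finite C" "l \<in> C" "Suc l \<notin> C"
  shows "count C v = count (lower l C) v + (if v = l then 1 else 0)"
proof -
  have fin: "finite (C \<inter> {..v} - {l})" using assms(1) by simp
  consider "v < l" | "v = l" | "l < v" by linarith
  then show ?thesis
  proof cases
    case 1
    then have "lower l C \<inter> {..v} = C \<inter> {..v}" by (auto simp: lower_def)
    then show ?thesis using 1 by (simp add: count_def)
  next
    case 2
    then have "C \<inter> {..v} = insert l (lower l C \<inter> {..v})" "l \<notin> lower l C \<inter> {..v}"
      using assms(2) by (auto simp: lower_def)
    then show ?thesis using 2 assms(1) by (simp add: count_def lower_def)
  next
    case 3
    have "lower l C \<inter> {..v} = insert (Suc l) (C \<inter> {..v} - {l})" using 3 by (auto simp: lower_def)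
    moreover have "C \<inter> {..v} = insert l (C \<inter> {..v} - {l})" using 3 assms(2) by auto
    ultimately have "count (lower l C) v = Suc (card (C \<inter> {..v} - {l}))" "count C v = Suc (card (C \<inter> {..v} - {l}))"
      using assms(3) fin card_insert_disjoint[OF fin, of l] card_insert_disjoint[OF fin, of "Suc l"]
      by (auto simp: count_def)
    then show ?thesis using 3 by simp
  qed
qed

text \<open>
  Where two comparable counting functions touch, their increments are comparable too: the one
  below cannot increase less just before, nor more just after, the point of contact.
\<close>

lemma count_tight:
  assumes fin: "finite C" "finite D" and le: "\<And>v. count C v \<le> count D v"
    and l: "1 \<le> l" "count D l \<le> count C l"
  shows "l \<in> D \<Longrightarrow> l \<in> C" "Suc l \<in> C \<Longrightarrow> Suc l \<in> D"
proof -
  obtain w where w: "l = Suc w" using l(1) by (cases l) auto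
  show "l \<in> D \<Longrightarrow> l \<in> C"
    using count_Suc[OF fin(1), of w] count_Suc[OF fin(2), of w] le[of w] l(2) w
    by (simp split: if_splits)
  show "Suc l \<in> C \<Longrightarrow> Suc l \<in> D"
    using count_Suc[OF fin(1), of l] count_Suc[OF fin(2), of l] le[of "Suc l"] l(2)
    by (simp split: if_splits)
qed

text \<open>
  Lowering the column with the larger counting function can only destroy the inequality if both
  functions agree at \<open>l\<close>; by \<open>count_tight\<close> the other column could then be lowered as well.
\<close>

lemma le_lower:
  assumes fin: "finite C" "finite D" and le: "\<And>v. count C v \<le> count D v"
    and D: "l \<in> D" "Suc l \<notin> D" and l: "1 \<le> l" and C: "\<not> (l \<in> C \<and> Suc l \<notin> C)"
  shows "count C v \<le> count (lower l D) v"
proof (cases "v = l")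
  case True
  have "\<not> count D l \<le> count C l" using count_tight[OF fin le l] C D by blast
  then show ?thesis using count_lower[OF fin(2) D, of v] True by simp
next
  case False
  then show ?thesis using count_lower[OF fin(2) D, of v] le[of v] by simp
qed

text \<open>
  The mirror image of \<open>le_lower\<close> for undoing a lowering of the column with the smaller counting
  function.
\<close>

lemma unlower_le:
  assumes fin: "finite C" "finite D" and C: "l \<in> C" "Suc l \<notin> C"
    and le: "\<And>v. count (lower l C) v \<le> count D v"
    and l: "1 \<le> l" and D: "\<not> (l \<notin> D \<and> Suc l \<in> D)"
  shows "count C v \<le> count D v"
proof (cases "v = l")
  case True
  have fl: "finite (lower l C)" using fin by (simp add: lower_def)
  have "l \<notin> lower l C" "Suc l \<in> lower l C" by (auto simp: lower_def)
  then have "\<not> count D l \<le> count (lower l C) l" using count_tight[OF fl fin(2) le l] D by blast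
  then show ?thesis using count_lower[OF fin(1) C, of v] True by simp
next
  case False
  then show ?thesis using count_lower[OF fin(1) C, of v] le[of v] by simp
qed

section \<open>The maps \<open>\<theta>\<^sub>l\<close> on columns\<close>

lemma mem_column_iff:
  assumes "(i, xs) \<in> R n i s" "1 \<le> l"
  shows "l \<in> column (i, xs) \<longleftrightarrow> (if l \<le> i then l \<notin> fst ` set xs else l - 1 \<in> snd ` set xs)"
proof (cases "l \<le> i")
  case True
  have "l \<notin> Suc ` snd ` set xs" using R_D(5)[OF assms(1)] True by fastforce
  then show ?thesis using True assms(2) by (simp add: column_def)
next
  case False
  have "l \<in> Suc ` snd ` set xs \<longleftrightarrow> l - 1 \<in> snd ` set xs" using assms(2) by (cases l) auto
  then show ?thesis using False by (simp add: column_def)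
qed

lemma prop_a_iff:
  assumes x: "x \<in> R n i s" and l: "1 \<le> l"
  shows "prop_a l x \<longleftrightarrow> l \<in> column x \<and> Suc l \<notin> column x"
proof -
  obtain xs where xs: "x = (i, xs)" "(i, xs) \<in> R n i s" using x by (auto simp: R_def)
  note D = R_D(4,5)[OF xs(2)]
  have X: "a \<notin> fst ` set xs" if "i < a" for a using D(1) that by fastforce
  have X': "a \<notin> snd ` set xs" if "a < i" for a using D(2) that by fastforce
  show ?thesis using mem_column_iff[OF xs(2) l] mem_column_iff[OF xs(2), of "Suc l"] X[of l] X'[of l]
      X[of "Suc l"]
    unfolding xs(1) prop_a_def prod.case
    by (cases l i rule: linorder_cases) (simp_all, blast+)
qed

lemma prop_c_iff:
  assumes x: "x \<in> R n i s" and l: "1 \<le> l"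
  shows "prop_c l x \<longleftrightarrow> l \<notin> column x \<and> Suc l \<in> column x"
proof -
  obtain xs where xs: "x = (i, xs)" "(i, xs) \<in> R n i s" using x by (auto simp: R_def)
  note D = R_D(4,5)[OF xs(2)]
  have X: "a \<notin> fst ` set xs" if "i < a" for a using D(1) that by fastforce
  have X': "a \<notin> snd ` set xs" if "a < i" for a using D(2) that by fastforce
  \<comment> \<open>For \<open>l = i\<close>, only the innermost pair, at the head of the list, can contain \<open>i\<close>.\<close>
  have hd: "xs \<noteq> [] \<and> hd xs = (i, i) \<longleftrightarrow> i \<in> fst ` set xs \<and> i \<in> snd ` set xs"
  proof
    assume r: "i \<in> fst ` set xs \<and> i \<in> snd ` set xs"
    then obtain p ps where p: "xs = p # ps" by (cases xs) auto
    have st: "\<forall>b\<in>set ps. fst b < fst p \<and> snd p < snd b" using R_D(3)[OF xs(2)] p by auto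
    have p1: "fst p \<le> i" "i \<le> snd p" using D(1)[of "fst p"] D(2)[of "snd p"] p by auto
    have "fst p = i" using r st p1 p by fastforce
    moreover have "snd p = i" using r st p1 p by fastforce
    ultimately show "xs \<noteq> [] \<and> hd xs = (i, i)" using p by (simp add: prod_eq_iff)
  next
    assume "xs \<noteq> [] \<and> hd xs = (i, i)"
    then have "(i, i) \<in> set xs" by (metis hd_in_set)
    then show "i \<in> fst ` set xs \<and> i \<in> snd ` set xs" by force
  qed
  show ?thesis using mem_column_iff[OF xs(2) l] mem_column_iff[OF xs(2), of "Suc l"] X[of l] X'[of l]
      X[of "Suc l"] hd
    unfolding xs(1) prop_c_def prod.case
    by (cases l i rule: linorder_cases) (simp_all, blast+)
qed

lemma R_map:
  assumes x: "(i, xs) \<in> R n i s"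
    and f: "strict_mono_on (fst ` set xs) f" "\<And>a. a \<in> fst ` set xs \<Longrightarrow> 1 \<le> f a \<and> f a \<le> i"
    and g: "strict_mono_on (snd ` set xs) g" "\<And>a. a \<in> snd ` set xs \<Longrightarrow> i \<le> g a \<and> g a \<le> n"
  shows "(i, map (\<lambda>(a, a'). (f a, g a')) xs) \<in> R n i s"
proof -
  have "sorted_wrt (\<lambda>a b. fst b < fst a \<and> snd a < snd b) (map (\<lambda>(a, a'). (f a, g a')) xs)"
    unfolding sorted_wrt_map
  proof (rule sorted_wrt_mono_rel[OF _ R_D(3)[OF x]])
    fix a b assume "a \<in> set xs" "b \<in> set xs" "fst b < fst a \<and> snd a < snd b"
    then show "fst (case b of (a, a') \<Rightarrow> (f a, g a')) < fst (case a of (a, a') \<Rightarrow> (f a, g a')) \<and>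
       snd (case a of (a, a') \<Rightarrow> (f a, g a')) < snd (case b of (a, a') \<Rightarrow> (f a, g a'))"
      using strict_mono_onD[OF f(1), of "fst b" "fst a"] strict_mono_onD[OF g(1), of "snd a" "snd b"]
      by (simp add: case_prod_beta)
  qed
  moreover have "1 \<le> f a \<and> f a \<le> i \<and> i \<le> g b \<and> g b \<le> n" if "(a, b) \<in> set xs" for a b
    using f(2)[of a] g(2)[of b] that by force
  ultimately show ?thesis using R_D(2)[OF x] unfolding R_def by fastforce
qed

lemma fst_set_map_pair: "fst ` set (map (\<lambda>(a, a'). (f a, g a')) xs) = f ` fst ` set xs"
  and snd_set_map_pair: "snd ` set (map (\<lambda>(a, a'). (f a, g a')) xs) = g ` snd ` set xs"
  by (induction xs) auto

lemma image_replace: "a \<in> A \<Longrightarrow> (\<lambda>c. if c = a then b else c) ` A = insert b (A - {a})"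
  by auto

lemma strict_mono_on_replace:
  fixes A :: "nat set"
  assumes "b \<notin> A" "b = Suc a \<or> a = Suc b"
  shows "strict_mono_on A (\<lambda>c. if c = a then b else c)"
  unfolding strict_mono_on_def
proof (intro allI impI)
  fix r t assume "r \<in> A \<and> t \<in> A \<and> r < t"
  then have "r \<noteq> b" "t \<noteq> b" "r < t" using assms(1) by auto
  then show "(if r = a then b else r) < (if t = a then b else t)" using assms(2) by auto
qed

lemma R_replace_fst:
  assumes x: "(i, xs) \<in> R n i s" and b: "b \<notin> fst ` set xs" "b = Suc a \<or> a = Suc b" "1 \<le> b" "b \<le> i"
  shows "(i, map (\<lambda>(c, c'). (if c = a then b else c, c')) xs) \<in> R n i s"
proof (rule R_map[OF x strict_mono_on_replace[OF b(1,2)], where g = "\<lambda>c. c"])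
  show "1 \<le> (if c = a then b else c) \<and> (if c = a then b else c) \<le> i" if "c \<in> fst ` set xs" for c
    using R_D(4)[OF x that] b by simp
  show "strict_mono_on (snd ` set xs) (\<lambda>c. c)" by (simp add: strict_mono_on_def)
  show "i \<le> c \<and> c \<le> n" if "c \<in> snd ` set xs" for c
    using R_D(5)[OF x that] .
qed

lemma R_replace_snd:
  assumes x: "(i, xs) \<in> R n i s" and b: "b \<notin> snd ` set xs" "b = Suc a \<or> a = Suc b" "i \<le> b" "b \<le> n"
  shows "(i, map (\<lambda>(c, c'). (c, if c' = a then b else c')) xs) \<in> R n i s"
proof (rule R_map[OF x _ _ strict_mono_on_replace[OF b(1,2)], where f = "\<lambda>c. c"])
  show "i \<le> (if c = a then b else c) \<and> (if c = a then b else c) \<le> n" if "c \<in> snd ` set xs" for c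
    using R_D(5)[OF x that] b by simp
  show "strict_mono_on (fst ` set xs) (\<lambda>c. c)" by (simp add: strict_mono_on_def)
  show "1 \<le> c \<and> c \<le> i" if "c \<in> fst ` set xs" for c
    using R_D(4)[OF x that] .
qed

lemma column_pair: "column (i, xs) = ({1..i} - fst ` set xs) \<union> Suc ` snd ` set xs"
  by (simp add: column_def)

lemma theta_Some:
  assumes x: "x \<in> R n i s" and l: "1 \<le> l" "l \<le> n" and th: "theta l x = Some y"
  shows "\<exists>s'. y \<in> R n i s'" "column y = lower l (column x)" "prop_a l x"
proof -
  obtain xs where xs: "x = (i, xs)" "(i, xs) \<in> R n i s" using x by (auto simp: R_def)
  note D = R_D[OF xs(2)]
  let ?X = "fst ` set xs" and ?Y = "snd ` set xs"
  have a: "prop_a l (i, xs)" using th xs(1) by (simp add: theta_def split: if_splits)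
  then show "prop_a l x" using xs(1) by simp
  have mem: "l \<notin> ?X" "l \<notin> ?Y" "l < i \<Longrightarrow> l + 1 \<in> ?X" "l > i \<Longrightarrow> l - 1 \<in> ?Y"
    using a by (simp_all add: prop_a_def)
  have Y: "l \<notin> Suc ` ?Y" if "l \<le> i" using D(5) that by fastforce
  consider "l < i" | "l = i" | "i < l" by linarith
  then have "(\<exists>s'. y \<in> R n i s') \<and> column y = lower l (column x)"
  proof cases
    case 1
    have y: "y = (i, map (\<lambda>(a, a'). (if a = l + 1 then l else a, a')) xs)"
      using th 1 a xs(1) by (simp add: theta_def)
    have "\<exists>s'. y \<in> R n i s'" unfolding y using R_replace_fst[OF xs(2) mem(1)] l 1 by auto
    moreover have "column y = ({1..i} - insert l (?X - {l + 1})) \<union> Suc ` ?Y"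
      unfolding y column_pair fst_set_map_pair snd_set_map_pair[where g = "\<lambda>c. c"]
        image_replace[OF mem(3)[OF 1]] by simp
    moreover have "\<dots> = insert (Suc l) (({1..i} - ?X) \<union> Suc ` ?Y - {l})"
      using 1 l Y by auto
    ultimately show ?thesis unfolding xs(1) column_pair lower_def by simp
  next
    case 2
    have y: "y = (i, (l, l) # xs)" using th 2 a xs(1) by (simp add: theta_def)
    have "\<forall>b\<in>set xs. fst b < l \<and> l < snd b"
    proof
      fix b assume b: "b \<in> set xs"
      then have "fst b \<in> ?X" "snd b \<in> ?Y" by auto
      then show "fst b < l \<and> l < snd b"
        using D(4)[of "fst b"] D(5)[of "snd b"] mem(1,2) 2 by (metis le_neq_implies_less)
    qed
    then have "y \<in> R n i (Suc s)" using xs(2) l 2 unfolding y by (simp add: R_def)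
    then have "\<exists>s'. y \<in> R n i s'" by blast
    moreover have "column y = ({1..i} - insert l ?X) \<union> insert (Suc l) (Suc ` ?Y)"
      unfolding y column_pair by simp
    moreover have "\<dots> = insert (Suc l) (({1..i} - ?X) \<union> Suc ` ?Y - {l})"
      using 2 l Y by auto
    ultimately show ?thesis unfolding xs(1) column_pair lower_def by simp
  next
    case 3
    have y: "y = (i, map (\<lambda>(a, a'). (a, if a' = l - 1 then l else a')) xs)"
      using th 3 a xs(1) by (simp add: theta_def)
    have "\<exists>s'. y \<in> R n i s'" unfolding y using R_replace_snd[OF xs(2) mem(2), of "l - 1"] l 3 by auto
    moreover have "column y = ({1..i} - ?X) \<union> insert (Suc l) (Suc ` (?Y - {l - 1}))"
      unfolding y column_pair fst_set_map_pair[where f = "\<lambda>c. c"] snd_set_map_pair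
        image_replace[OF mem(4)[OF 3]] by simp
    moreover have "\<dots> = insert (Suc l) (({1..i} - ?X) \<union> Suc ` ?Y - {l})"
    proof -
      have "Suc ` (?Y - {l - 1}) = Suc ` ?Y - {l}" using l(1) by (simp add: image_set_diff)
      moreover have "l \<notin> {1..i}" using 3 by simp
      ultimately show ?thesis by blast
    qed
    ultimately show ?thesis unfolding xs(1) column_pair lower_def by simp
  qed
  then show "\<exists>s'. y \<in> R n i s'" "column y = lower l (column x)" by blast+
qed

lemma theta_preimage:
  assumes y: "y \<in> R n i s" and l: "1 \<le> l" "l \<le> n" and c: "prop_c l y"
  shows "\<exists>s'. \<exists>x \<in> R n i s'. theta l x = Some y"
proof -
  obtain ys where ys: "y = (i, ys)" "(i, ys) \<in> R n i s" using y by (auto simp: R_def)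
  note D = R_D[OF ys(2)]
  let ?X = "fst ` set ys" and ?Y = "snd ` set ys"
  have X: "a \<notin> ?X" if "i < a" for a using D(4)[of a] that by linarith
  have Y: "a \<notin> ?Y" if "a < i" for a using D(5)[of a] that by linarith
  have c': "prop_c l (i, ys)" using c ys(1) by simp
  have mem: "l < i \<Longrightarrow> l + 1 \<notin> ?X" "l > i \<Longrightarrow> l - 1 \<notin> ?Y" "l < i \<Longrightarrow> l \<in> ?X" "l > i \<Longrightarrow> l \<in> ?Y"
    using c' X[of l] Y[of l] by (simp_all add: prop_c_def)
  consider "l < i" | "l = i" | "i < l" by linarith
  then show ?thesis
  proof cases
    case 1
    define xs where "xs = map (\<lambda>(a, a'). (if a = l then l + 1 else a, a')) ys"
    have R: "(i, xs) \<in> R n i s" unfolding xs_def using R_replace_fst[OF ys(2) mem(1)[OF 1]] 1 by simp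
    have "fst ` set xs = insert (l + 1) (?X - {l})"
      unfolding xs_def fst_set_map_pair by (rule image_replace[OF mem(3)[OF 1]])
    moreover have "snd ` set xs = ?Y"
      unfolding xs_def snd_set_map_pair[where g = "\<lambda>c. c"] by simp
    ultimately have "prop_a l (i, xs)" using 1 Y[OF 1] by (simp add: prop_a_def)
    moreover have "map (\<lambda>(a, a'). (if a = l + 1 then l else a, a')) xs = ys"
      unfolding xs_def map_map
    proof (rule map_idI)
      fix b assume "b \<in> set ys"
      then have "fst b \<noteq> l + 1" using mem(1)[OF 1] by (metis image_eqI)
      then show "((\<lambda>(a, a'). (if a = l + 1 then l else a, a')) \<circ>
          (\<lambda>(a, a'). (if a = l then l + 1 else a, a'))) b = b" by (cases b) simp
    qed
    ultimately have "theta l (i, xs) = Some y" using 1 ys(1) by (simp add: theta_def)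
    then show ?thesis using R by blast
  next
    case 2
    have "ys \<noteq> []" "hd ys = (l, l)" using c' 2 by (simp_all add: prop_c_def)
    then obtain xs where xs: "ys = (l, l) # xs" by (cases ys) simp_all
    have R: "(i, xs) \<in> R n i (length xs)" using ys(2) xs by (simp add: R_def)
    have "l \<notin> fst ` set xs" "l \<notin> snd ` set xs" using D(3) xs by auto
    then have "prop_a l (i, xs)" using 2 by (simp add: prop_a_def)
    then have "theta l (i, xs) = Some y" using 2 ys(1) xs by (simp add: theta_def)
    then show ?thesis using R by blast
  next
    case 3
    define xs where "xs = map (\<lambda>(a, a'). (a, if a' = l then l - 1 else a')) ys"
    have R: "(i, xs) \<in> R n i s" unfolding xs_def using R_replace_snd[OF ys(2) mem(2)[OF 3], of l] l 3 by simp
    have "snd ` set xs = insert (l - 1) (?Y - {l})"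
      unfolding xs_def snd_set_map_pair by (rule image_replace[OF mem(4)[OF 3]])
    moreover have "fst ` set xs = ?X"
      unfolding xs_def fst_set_map_pair[where f = "\<lambda>c. c"] by simp
    ultimately have "prop_a l (i, xs)" using 3 X[OF 3] by (simp add: prop_a_def)
    moreover have "map (\<lambda>(a, a'). (a, if a' = l - 1 then l else a')) xs = ys"
      unfolding xs_def map_map
    proof (rule map_idI)
      fix b assume "b \<in> set ys"
      then have "snd b \<noteq> l - 1" using mem(2)[OF 3] by (metis image_eqI)
      then show "((\<lambda>(a, a'). (a, if a' = l - 1 then l else a')) \<circ>
          (\<lambda>(a, a'). (a, if a' = l then l - 1 else a'))) b = b" by (cases b) simp
    qed
    ultimately have "theta l (i, xs) = Some y" using 3 ys(1) by (simp add: theta_def)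
    then show ?thesis using R by blast
  qed
qed

section \<open>The signature rule\<close>

text \<open>
  The difference \<open>\<sigma> - \<tau>\<close>, with components counted from \<open>0\<close>. As the first component is ignored
  in \<open>\<tau>\<close>, it starts with the value \<open>0\<close>.
\<close>

definition depth :: "nat \<Rightarrow> (nat \<Rightarrow> rseq option) \<Rightarrow> nat \<Rightarrow> int" where
  "depth l x q = sigma l x (Suc q) - tau l x (Suc q)"

lemma num_nz_eq:
  assumes "\<And>q. x q \<noteq> None \<longleftrightarrow> q < k"
  shows "num_nz x = k"
  using assms by (simp add: num_nz_def)

lemma nz_pos_eq:
  assumes "\<And>q. x q \<noteq> None \<longleftrightarrow> q < k" "1 \<le> p" "p \<le> k"
  shows "nz_pos x p = p - 1"
proof -
  have "{q. x q \<noteq> None} = set [0..<k]" using assms(1) by auto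
  then have "sorted_list_of_set {q. x q \<noteq> None} = [0..<k]"
    by (metis sorted_list_of_set.idem_if_sorted_distinct sorted_upt distinct_upt)
  then show ?thesis using assms(2,3) by (simp add: nz_pos_def)
qed

lemma depth_0: "depth l x 0 = 0"
proof -
  have "{p. 1 \<le> p \<and> p \<le> Suc 0 - 1 \<and> P p} = {}" "{p. 2 \<le> p \<and> p \<le> Suc 0 \<and> P p} = {}" for P
    by auto
  then show ?thesis by (simp only: depth_def sigma_def tau_def card.empty)
qed

lemma depth_Suc:
  assumes supp: "\<And>q. x q \<noteq> None \<longleftrightarrow> q < k" and q: "Suc q < k"
  shows "depth l x (Suc q) = depth l x q
    + (if prop_a l (the (x q)) then 1 else 0) - (if prop_c l (the (x (Suc q))) then 1 else 0)"
proof -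
  have nz: "nz_pos x (Suc q) = q" "nz_pos x (Suc (Suc q)) = Suc q"
    using nz_pos_eq[of x k, OF supp] q by auto
  have "{p. 1 \<le> p \<and> p \<le> Suc (Suc q) - 1 \<and> prop_a l (the (x (nz_pos x p)))} =
    (if prop_a l (the (x q)) then {Suc q} else {})
      \<union> {p. 1 \<le> p \<and> p \<le> Suc q - 1 \<and> prop_a l (the (x (nz_pos x p)))}"
    using nz(1) by (auto simp: le_Suc_eq)
  moreover have "finite {p. 1 \<le> p \<and> p \<le> Suc q - 1 \<and> prop_a l (the (x (nz_pos x p)))}"
    by (rule finite_subset[of _ "{..q}"]) auto
  ultimately have 1: "sigma l x (Suc (Suc q)) = sigma l x (Suc q) + (if prop_a l (the (x q)) then 1 else 0)"
    unfolding sigma_def by (simp add: card_insert_if)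
  have "{p. 2 \<le> p \<and> p \<le> Suc (Suc q) \<and> prop_c l (the (x (nz_pos x p)))} =
    (if prop_c l (the (x (Suc q))) then {Suc (Suc q)} else {})
      \<union> {p. 2 \<le> p \<and> p \<le> Suc q \<and> prop_c l (the (x (nz_pos x p)))}"
    using nz(2) by (auto simp: le_Suc_eq)
  moreover have "finite {p. 2 \<le> p \<and> p \<le> Suc q \<and> prop_c l (the (x (nz_pos x p)))}"
    by (rule finite_subset[of _ "{..Suc q}"]) auto
  ultimately have 2: "tau l x (Suc (Suc q)) = tau l x (Suc q) + (if prop_c l (the (x (Suc q))) then 1 else 0)"
    unfolding tau_def by (simp add: card_insert_if)
  show ?thesis unfolding depth_def 1 2 by simp
qed

text \<open>
  The component on which \<open>f\<^sub>l\<close> acts: the last position among the first \<open>k\<close> where \<open>depth\<close> attains its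
  minimum.
\<close>

definition last_min :: "nat \<Rightarrow> nat \<Rightarrow> (nat \<Rightarrow> rseq option) \<Rightarrow> nat \<Rightarrow> bool" where
  "last_min k l x q \<longleftrightarrow> q < k \<and> (\<forall>r<k. depth l x q \<le> depth l x r)
     \<and> (\<forall>r<k. q < r \<longrightarrow> depth l x q < depth l x r)"

lemma f_index_last_min:
  assumes nz: "num_nz x = k" and k: "0 < k"
  shows "\<exists>q. f_index l x = Suc q \<and> last_min k l x q"
proof -
  let ?g = "\<lambda>j. sigma l x j - tau l x j"
  let ?S = "{p \<in> {1..k}. ?g p = mu l x}"
  have mu: "mu l x = Min (?g ` {1..k})" unfolding mu_def nz ..
  have "mu l x \<in> ?g ` {1..k}" unfolding mu using k by (intro Min_in) auto
  then have "?S \<noteq> {}" by force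
  then have "Max ?S \<in> ?S" by (intro Max_in) auto
  moreover have "f_index l x = Max ?S" unfolding f_index_def nz ..
  ultimately have f: "1 \<le> f_index l x" "f_index l x \<le> k" "?g (f_index l x) = mu l x" by auto
  then obtain q where q: "f_index l x = Suc q" by (cases "f_index l x") auto
  have min: "depth l x q \<le> depth l x r" if "r < k" for r
  proof -
    have "mu l x \<le> ?g (Suc r)" unfolding mu using that by (intro Min_le) auto
    then show ?thesis using f(3) q by (simp add: depth_def)
  qed
  moreover have "depth l x q < depth l x r" if r: "r < k" "q < r" for r
  proof (rule ccontr)
    assume "\<not> depth l x q < depth l x r"
    then have "?g (Suc r) = mu l x" using min[OF r(1)] f(3) q by (simp add: depth_def)
    then have "Suc r \<in> ?S" using r by simp
    then have "Suc r \<le> Max ?S" by (intro Max_ge) auto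
    then show False using r(2) q \<open>f_index l x = Max ?S\<close> by simp
  qed
  ultimately show ?thesis using q f(2) unfolding last_min_def by auto
qed

lemma last_min_unique:
  assumes "last_min k l x q" "last_min k l x r"
  shows "q = r"
  using assms unfolding last_min_def by (metis linorder_neqE_nat not_less)

lemma f_op_Some_iff:
  assumes supp: "\<And>q. x q \<noteq> None \<longleftrightarrow> q < k"
  shows "f_op l x = Some y \<longleftrightarrow>
    (\<exists>q z. last_min k l x q \<and> theta l (the (x q)) = Some z \<and> y = x(q := Some z))"
proof (cases "k = 0")
  case True
  then show ?thesis using num_nz_eq[of x k, OF supp] by (simp add: f_op_def last_min_def)
next
  case False
  then obtain q where q: "f_index l x = Suc q" "last_min k l x q" using f_index_last_min[of x k] num_nz_eq[of x k, OF supp] by blast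
  then have "nz_pos x (f_index l x) = q" using nz_pos_eq[of x k "Suc q", OF supp] by (simp add: last_min_def)
  then have "f_op l x = Some y \<longleftrightarrow> (\<exists>z. theta l (the (x q)) = Some z \<and> y = x(q := Some z))"
    using False num_nz_eq[of x k, OF supp] by (auto simp: f_op_def split: option.splits)
  then show ?thesis using q(2) last_min_unique by blast
qed

section \<open>Semistandard sequences are stable under the Kashiwara operators\<close>

text \<open>
  Sequences of the shape prescribed by \<open>d\<close>: exactly the first \<open>k\<close> components are non-zero, and
  component \<open>q\<close> has superscript \<open>d q\<close>.
\<close>

definition filling :: "nat \<Rightarrow> nat \<Rightarrow> (nat \<Rightarrow> nat) \<Rightarrow> (nat \<Rightarrow> rseq option) \<Rightarrow> bool" where
  "filling n k d x \<longleftrightarrow> (\<forall>q<k. \<exists>s. \<exists>y \<in> R n (d q) s. x q = Some y) \<and> (\<forall>q\<ge>k. x q = None)"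

text \<open>
  If \<open>d\<close> is weakly increasing, the columns of \<open>x\<close>, read from right to left, form a semistandard
  tableau if and only if the counting functions weakly increase along \<open>x\<close>.
\<close>

definition semistandard :: "nat \<Rightarrow> nat \<Rightarrow> (nat \<Rightarrow> nat) \<Rightarrow> (nat \<Rightarrow> rseq option) \<Rightarrow> bool" where
  "semistandard n k d x \<longleftrightarrow> filling n k d x \<and> (\<forall>q v. Suc q < k \<longrightarrow>
     count (column (the (x q))) v \<le> count (column (the (x (Suc q)))) v)"

lemma filling_D:
  assumes "filling n k d x"
  shows "x q \<noteq> None \<longleftrightarrow> q < k" "q < k \<Longrightarrow> \<exists>s. the (x q) \<in> R n (d q) s"
proof -
  show "x q \<noteq> None \<longleftrightarrow> q < k" using assms unfolding filling_def by (cases "q < k") auto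
  show "q < k \<Longrightarrow> \<exists>s. the (x q) \<in> R n (d q) s" using assms unfolding filling_def by fastforce
qed

lemma filling_R_inf:
  assumes "filling n k d x" "\<And>q. q < k \<Longrightarrow> d q \<in> {1..n}"
  shows "x \<in> R_inf n"
proof -
  have "{q. x q \<noteq> None} = {..<k}" using filling_D(1)[OF assms(1)] by auto
  moreover have "\<exists>i\<in>{1..n}. \<exists>s. y \<in> R n i s" if "x q = Some y" for q y
    using filling_D[OF assms(1), of q] assms(2)[of q] that by auto
  ultimately show ?thesis unfolding R_inf_def by simp
qed

lemma f_op_filling:
  assumes x: "filling n k d x" and l: "1 \<le> l" "l \<le> n" and f: "f_op l x = Some y"
  obtains q z where "last_min k l x q" "q < k" "y = x(q := Some z)" "filling n k d y"
    "l \<in> column (the (x q))" "Suc l \<notin> column (the (x q))" "column z = lower l (column (the (x q)))"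
proof -
  obtain q z where q: "last_min k l x q" "theta l (the (x q)) = Some z" "y = x(q := Some z)"
    using f f_op_Some_iff[of x k, OF filling_D(1)[OF x]] by blast
  have qk: "q < k" using q(1) by (simp add: last_min_def)
  then obtain s where s: "the (x q) \<in> R n (d q) s" using filling_D(2)[OF x] by blast
  note t = theta_Some[OF s l q(2)]
  have "filling n k d y" using x t(1) qk unfolding filling_def q(3) by auto
  then show ?thesis using that q t qk prop_a_iff[OF s l(1)] by blast
qed

text \<open>
  If \<open>f\<^sub>l\<close> acts on a component without (c), its left neighbour does not satisfy (a): otherwise
  \<open>depth\<close> would be smaller at this neighbour.
\<close>

lemma last_min_left:
  assumes supp: "\<And>q. x q \<noteq> None \<longleftrightarrow> q < k" and q: "last_min k l x (Suc q)"
    "\<not> prop_c l (the (x (Suc q)))"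
  shows "\<not> prop_a l (the (x q))"
  using depth_Suc[of x k q l, OF supp] q unfolding last_min_def
  by (auto dest!: spec[of _ q])

text \<open>
  If \<open>f\<^sub>l\<close> acts on a component with (a), its right neighbour does not satisfy (c): otherwise
  \<open>depth\<close> would attain its minimum again at this neighbour.
\<close>

lemma last_min_right:
  assumes supp: "\<And>q. x q \<noteq> None \<longleftrightarrow> q < k" and q: "last_min k l x q" "Suc q < k"
    "prop_a l (the (x q))"
  shows "\<not> prop_c l (the (x (Suc q)))"
  using depth_Suc[of x k q l, OF supp] q unfolding last_min_def
  by (auto dest!: spec[of _ "Suc q"])

lemma semistandard_f_op:
  assumes x: "semistandard n k d x" and l: "1 \<le> l" "l \<le> n" and f: "f_op l x = Some y"
  shows "semistandard n k d y"
proof -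
  have fx: "filling n k d x" and le: "\<And>q v. Suc q < k \<Longrightarrow>
     count (column (the (x q))) v \<le> count (column (the (x (Suc q)))) v"
    using x by (auto simp: semistandard_def)
  obtain q z where q: "last_min k l x q" "q < k" "y = x(q := Some z)" and fy: "filling n k d y"
    and c: "l \<in> column (the (x q))" "Suc l \<notin> column (the (x q))" "column z = lower l (column (the (x q)))"
    by (rule f_op_filling[OF fx l f])
  have "count (column (the (y r))) v \<le> count (column (the (y (Suc r)))) v" if r: "Suc r < k" for r v
  proof -
    consider "r = q" | "Suc r = q" | "r \<noteq> q" "Suc r \<noteq> q" by blast
    then show ?thesis
    proof cases
      case 1
      then show ?thesis using le[OF r, of v] count_lower[OF finite_column c(1,2), of v] q(3) c(3) by simp
    next
      case 2
      obtain s where s: "the (x q) \<in> R n (d q) s" using filling_D(2)[OF fx q(2)] by blast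
      obtain s' where s': "the (x r) \<in> R n (d r) s'" using filling_D(2)[OF fx, of r] r by auto
      have "\<not> prop_c l (the (x q))" using prop_c_iff[OF s l(1)] c by simp
      then have "\<not> prop_a l (the (x r))"
        using last_min_left[of x k l r, OF filling_D(1)[OF fx]] q(1) 2 by simp
      then have "\<not> (l \<in> column (the (x r)) \<and> Suc l \<notin> column (the (x r)))"
        using prop_a_iff[OF s' l(1)] by simp
      then have "count (column (the (x r))) v \<le> count (lower l (column (the (x q)))) v"
        using le[OF r] 2 by (intro le_lower[OF finite_column finite_column _ c(1,2) l(1)]) auto
      then show ?thesis using 2 q(3) c(3) by auto
    next
      case 3
      then show ?thesis using le[OF r] q(3) by simp
    qed
  qed
  then show ?thesis using fy by (simp add: semistandard_def)
qed

lemma semistandard_f_op_inverse: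
  assumes x: "filling n k d x" and y: "semistandard n k d y"
    and l: "1 \<le> l" "l \<le> n" and f: "f_op l x = Some y"
  shows "semistandard n k d x"
proof -
  have le: "\<And>q v. Suc q < k \<Longrightarrow>
     count (column (the (y q))) v \<le> count (column (the (y (Suc q)))) v"
    using y by (auto simp: semistandard_def)
  obtain q z where q: "last_min k l x q" "q < k" "y = x(q := Some z)"
    and c: "l \<in> column (the (x q))" "Suc l \<notin> column (the (x q))" "column z = lower l (column (the (x q)))"
    by (rule f_op_filling[OF x l f])
  have "count (column (the (x r))) v \<le> count (column (the (x (Suc r)))) v" if r: "Suc r < k" for r v
  proof -
    consider "r = q" | "Suc r = q" | "r \<noteq> q" "Suc r \<noteq> q" by blast
    then show ?thesis
    proof cases
      case 1
      obtain s where s: "the (x q) \<in> R n (d q) s" using filling_D(2)[OF x q(2)] by blast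
      obtain s' where s': "the (x (Suc r)) \<in> R n (d (Suc r)) s'" using filling_D(2)[OF x r] by auto
      have "prop_a l (the (x q))" using prop_a_iff[OF s l(1)] c by simp
      then have "\<not> prop_c l (the (x (Suc r)))"
        using last_min_right[of x k l q, OF filling_D(1)[OF x]] q(1) 1 r by simp
      then have "\<not> (l \<notin> column (the (x (Suc r))) \<and> Suc l \<in> column (the (x (Suc r))))"
        using prop_c_iff[OF s' l(1)] by simp
      moreover have "count (lower l (column (the (x q)))) w \<le> count (column (the (x (Suc r)))) w" for w
        using le[OF r, of w] 1 q(3) c(3) by simp
      ultimately have "count (column (the (x q))) v \<le> count (column (the (x (Suc r)))) v"
        by (intro unlower_le[OF finite_column finite_column c(1,2) _ l(1)]) auto
      then show ?thesis using 1 by simp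
    next
      case 2
      have "count (column (the (x r))) v \<le> count (lower l (column (the (x q)))) v"
        using le[OF r, of v] 2 q(3) c(3) by auto
      then show ?thesis using count_lower[OF finite_column c(1,2), of v] 2 by simp
    next
      case 3
      then show ?thesis using le[OF r, of v] q(3) by simp
    qed
  qed
  then show ?thesis using x by (simp add: semistandard_def)
qed

section \<open>Raising to the highest weight element\<close>

text \<open>
  If some component satisfies (c) and no component before it satisfies (a), then \<open>y\<close> has a
  preimage under \<open>f\<^sub>l\<close>, namely its image under the raising operator: \<open>\<theta>\<^sub>l\<close> is undone at the first
  position where \<open>depth\<close> attains its minimum.
\<close>

lemma f_op_preimage_exists:
  assumes y: "filling n k d y" and l: "1 \<le> l" "l \<le> n"
    and q: "q < k" "prop_c l (the (y q))" "\<And>r. r < q \<Longrightarrow> \<not> prop_a l (the (y r))"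
  shows "\<exists>x. filling n k d x \<and> f_op l x = Some y"
proof -
  note supp = filling_D(1)[OF y]
  let ?h = "depth l y"
  \<comment> \<open>The minimum is negative unless \<open>q = 0\<close>, so it can be attained at \<open>0\<close> only if \<open>q = 0\<close>.\<close>
  have low: "?h q \<le> (if q = 0 then 0 else -1)"
  proof -
    have neg: "?h r \<le> 0" if "r \<le> q" for r
      using that
    proof (induction r)
      case (Suc r)
      then show ?case using depth_Suc[of y k r l, OF supp] q(1) q(3)[of r] by simp
    qed (simp add: depth_0)
    show ?thesis
    proof (cases q)
      case (Suc r)
      then show ?thesis using depth_Suc[of y k r l, OF supp] q(1,2) q(3)[of r] neg[of r] by simp
    qed (simp add: depth_0)
  qed
  define m where "m = Min (?h ` {..<k})"
  define p where "p = (LEAST r. r < k \<and> ?h r = m)"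
  have "m \<in> ?h ` {..<k}" unfolding m_def using q(1) by (intro Min_in) auto
  then have "\<exists>r. r < k \<and> ?h r = m" by auto
  from LeastI_ex[OF this] have p: "p < k" "?h p = m" unfolding p_def by auto
  have ge: "m \<le> ?h r" if "r < k" for r unfolding m_def using that by (intro Min_le) auto
  have gt: "m < ?h r" if "r < p" for r
    using ge[of r] not_less_Least[of r "\<lambda>r. r < k \<and> ?h r = m"] that p(1) unfolding p_def[symmetric] by auto
  have pc: "prop_c l (the (y p))"
  proof (cases p)
    case 0
    have "q = 0" using low ge[OF q(1)] p(2) 0 depth_0[of l y] by (simp split: if_splits)
    then show ?thesis using q(2) 0 by simp
  next
    case (Suc r)
    then show ?thesis using depth_Suc[of y k r l, OF supp] gt[of r] p by (simp split: if_splits)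
  qed
  obtain s where s: "the (y p) \<in> R n (d p) s" using filling_D(2)[OF y p(1)] by blast
  obtain s' z where z: "z \<in> R n (d p) s'" "theta l z = Some (the (y p))"
    using theta_preimage[OF s l pc] by blast
  define x where "x = y(p := Some z)"
  have fx: "filling n k d x" using y z(1) p(1) unfolding filling_def x_def by auto
  have xp: "the (x p) = z" and xn: "r \<noteq> p \<Longrightarrow> x r = y r" for r by (simp_all add: x_def)
  note suppx = filling_D(1)[OF fx]
  have az: "prop_a l z" using theta_Some(3)[OF z(1) l z(2)] .
  have cz: "\<not> prop_c l z" using az prop_a_iff[OF z(1) l(1)] prop_c_iff[OF z(1) l(1)] by blast
  have ap: "\<not> prop_a l (the (y p))" using pc prop_a_iff[OF s l(1)] prop_c_iff[OF s l(1)] by blast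
  \<comment> \<open>Passing from \<open>y\<close> to \<open>x\<close> shifts \<open>depth\<close> by \<open>0\<close> before \<open>p\<close>, by \<open>1\<close> at \<open>p\<close> and by \<open>2\<close> after \<open>p\<close> (one
    less from \<open>p\<close> on if \<open>p = 0\<close>), which makes \<open>p\<close> the last minimum.\<close>
  have before: "depth l x r = ?h r" if "r < p" for r
    using that
  proof (induction r)
    case (Suc r)
    then show ?case
      using depth_Suc[of y k r l, OF supp] depth_Suc[of x k r l, OF suppx] p(1) by (simp add: xp xn)
  qed (simp add: depth_0)
  have at: "depth l x p = ?h p + (if p = 0 then 0 else 1)"
  proof (cases p)
    case (Suc r)
    then show ?thesis
      using depth_Suc[of y k r l, OF supp] depth_Suc[of x k r l, OF suppx] p(1) before[of r] pc cz xp
      by (simp add: xn)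
  qed (simp add: depth_0)
  have after: "depth l x (Suc p + r) = ?h (Suc p + r) + (if p = 0 then 1 else 2)" if "Suc p + r < k" for r
    using that
  proof (induction r)
    case 0
    then show ?case
      using depth_Suc[of y k p l, OF supp] depth_Suc[of x k p l, OF suppx] at az ap
      by (simp add: xp xn)
  next
    case (Suc r)
    then show ?case
      using depth_Suc[of y k "Suc p + r" l, OF supp] depth_Suc[of x k "Suc p + r" l, OF suppx]
      by (simp add: xp xn)
  qed
  have lm: "depth l x p < depth l x r" if "p < r" "r < k" for r
    using after[of "r - Suc p"] ge[of r] that at p(2) by (simp split: if_splits)
  have "depth l x p \<le> depth l x r" if "r < k" for r
  proof (cases r p rule: linorder_cases)
    case less
    then show ?thesis using before gt[of r] at p(2) by simp
  qed (use lm[of r] that in auto)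
  then have "last_min k l x p" using lm p(1) by (simp add: last_min_def)
  moreover have "y p = Some (the (y p))" using supp[of p] p(1) by simp
  then have "y = x(p := Some (the (y p)))" by (simp add: x_def)
  ultimately have "f_op l x = Some y" using f_op_Some_iff[of x k, OF suppx] z(2) xp by metis
  then show ?thesis using fx by blast
qed

text \<open>
  Backward arrows start at an element of which only the membership in \<open>\<R>\<^sup>\<infinity>\<close> is known. As \<open>f\<^sub>l\<close>
  changes neither the set of non-zero components nor any superscript, it has the same shape.
\<close>

lemma f_op_preimage_filling:
  assumes x: "x \<in> R_inf n" and y: "filling n k d y" and l: "1 \<le> l" "l \<le> n"
    and f: "f_op l x = Some y"
  shows "filling n k d x"
proof -
  let ?S = "{q. x q \<noteq> None}"
  define q where "q = nz_pos x (f_index l x)"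
  have fin: "finite ?S" using x by (simp add: R_inf_def)
  have nz: "num_nz x > 0" using f by (auto simp: f_op_def split: if_splits)
  obtain z where z: "theta l (the (x q)) = Some z" "y = x(q := Some z)"
    using f nz unfolding q_def by (auto simp: f_op_def Let_def split: option.splits)
  obtain p where "f_index l x = Suc p" "p < num_nz x"
    using f_index_last_min[OF refl nz] unfolding last_min_def by blast
  then have "q \<in> set (sorted_list_of_set ?S)"
    unfolding q_def nz_pos_def num_nz_def by (auto intro!: nth_mem)
  then have "x q \<noteq> None" using fin by simp
  then obtain w where w: "x q = Some w" by auto
  then obtain i s where i: "w \<in> R n i s" using x unfolding R_inf_def by blast
  have qk: "q < k" using filling_D(1)[OF y, of q] z(2) by simp
  obtain s' where "z \<in> R n i s'" using theta_Some(1)[OF i l, of z] z(1) w by auto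
  moreover obtain s'' where "z \<in> R n (d q) s''" using filling_D(2)[OF y qk] z(2) by auto
  ultimately have "i = d q" by (auto simp: R_def)
  have "\<exists>s. \<exists>v \<in> R n (d r) s. x r = Some v" if "r < k" for r
  proof (cases "r = q")
    case True
    then show ?thesis using w i \<open>i = d q\<close> by blast
  next
    case False
    then have "y r = x r" using z(2) by simp
    then show ?thesis using y that unfolding filling_def by metis
  qed
  moreover have "x r = None" if "k \<le> r" for r
    using y that qk z(2) unfolding filling_def by (auto split: if_splits)
  ultimately show ?thesis unfolding filling_def by blast
qed

lemma semistandard_le:
  assumes x: "semistandard n k d x" and "r \<le> q" "q < k"
  shows "count (column (the (x r))) v \<le> count (column (the (x q))) v"
  using assms(2,3)
proof (induction q rule: dec_induct)
  case (step q)
  then show ?case using x unfolding semistandard_def by (meson Suc_lessD le_trans)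
qed simp

lemma sum_lower:
  assumes "finite C" "l \<in> C" "Suc l \<notin> C"
  shows "\<Sum>(lower l C) = Suc (\<Sum>C)"
proof -
  have "\<Sum>C = l + \<Sum>(C - {l})" using assms by (simp add: sum.remove)
  then show ?thesis using assms by (simp add: lower_def)
qed

text \<open>
  A nonempty sequence removes some \<open>a\<close> from the column and adds some \<open>b + 1 > a\<close>; the least element
  of the column above \<open>a\<close> can be decreased.
\<close>

lemma column_raisable:
  assumes x: "(i, xs) \<in> R n i s" and ne: "xs \<noteq> []"
  obtains l where "1 \<le> l" "l \<le> n" "l \<notin> column (i, xs)" "Suc l \<in> column (i, xs)"
proof -
  note D = R_D(4,5)[OF x]
  obtain a b where ab: "(a, b) \<in> set xs" using ne by (cases xs) auto
  have a: "a \<in> fst ` set xs" and b: "b \<in> snd ` set xs" using ab by force+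
  have "a \<notin> column (i, xs)" using mem_column_iff[OF x, of a] D(1)[OF a] a by simp
  moreover have "Suc b \<in> column (i, xs)" using b by (simp add: column_def)
  moreover have "a \<le> b" using D(1)[OF a] D(2)[OF b] by simp
  moreover define c where "c = (LEAST c. a < c \<and> c \<in> column (i, xs))"
  ultimately have "a < Suc b \<and> Suc b \<in> column (i, xs)" by simp
  then have c: "a < c" "c \<in> column (i, xs)" "c \<le> Suc b"
    unfolding c_def using LeastI[of "\<lambda>c. a < c \<and> c \<in> column (i, xs)" "Suc b"]
      Least_le[of "\<lambda>c. a < c \<and> c \<in> column (i, xs)" "Suc b"] by auto
  obtain l where l: "c = Suc l" using c(1) by (cases c) auto
  have "l \<notin> column (i, xs)"
  proof (cases "l = a")
    case False
    then show ?thesis using c(1) l not_less_Least[of l "\<lambda>c. a < c \<and> c \<in> column (i, xs)"]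
      unfolding c_def[symmetric] by auto
  qed (use \<open>a \<notin> column (i, xs)\<close> in simp)
  then show ?thesis using that[of l] c l D(1)[OF a] D(2)[OF b] by auto
qed

text \<open>
  In the first column that is not of the form \<open>{1..i}\<close> some entry \<open>l + 1\<close> can be decreased to \<open>l\<close>.
  An earlier column satisfies (a) only if it is \<open>{1..l}\<close>, and then semistandardness would
  force \<open>l\<close> into the column under consideration. Hence \<open>f_op_preimage_exists\<close> applies.
\<close>

lemma semistandard_raise:
  assumes y: "semistandard n k d y" and ne: "q < k" "y q \<noteq> Some (d q, [])"
  obtains l x where "1 \<le> l" "l \<le> n" "semistandard n k d x" "f_op l x = Some y"
proof -
  have fy: "filling n k d y" using y by (simp add: semistandard_def)
  define p where "p = (LEAST q. q < k \<and> y q \<noteq> Some (d q, []))"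
  have p: "p < k" "y p \<noteq> Some (d p, [])"
    unfolding p_def using LeastI[of "\<lambda>q. q < k \<and> y q \<noteq> Some (d q, [])" q] ne by auto
  have before: "y r = Some (d r, [])" if "r < p" for r
    using not_less_Least[of r "\<lambda>q. q < k \<and> y q \<noteq> Some (d q, [])"] that p(1)
    unfolding p_def[symmetric] by auto
  obtain s xs where xs: "y p = Some (d p, xs)" "(d p, xs) \<in> R n (d p) s"
    using fy p(1) unfolding filling_def by (auto simp: R_def)
  then have "xs \<noteq> []" using p(2) by auto
  then obtain l where l: "1 \<le> l" "l \<le> n" "l \<notin> column (d p, xs)" "Suc l \<in> column (d p, xs)"
    using column_raisable[OF xs(2)] by blast
  have "prop_c l (the (y p))" using prop_c_iff[OF xs(2) l(1)] l(3,4) xs(1) by simp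
  moreover have "\<not> prop_a l (the (y r))" if r: "r < p" for r
  proof
    assume "prop_a l (the (y r))"
    then have dr: "d r = l" using before[OF r] by (auto simp: prop_a_def)
    have "column (the (y r)) \<inter> {..l} = {1..l}" using before[OF r] dr by (auto simp: column_def)
    then have "l \<le> count (column (the (y p))) l"
      using semistandard_le[OF y, of r p l] r p(1) by (simp add: count_def)
    moreover have "column (d p, xs) \<inter> {..l} \<subseteq> {1..<l}"
    proof
      fix c assume c: "c \<in> column (d p, xs) \<inter> {..l}"
      then have "c \<noteq> l" using l(3) by auto
      then show "c \<in> {1..<l}" using c by (auto simp: column_def)
    qed
    then have "count (column (d p, xs)) l \<le> card {1..<l}"
      unfolding count_def by (rule card_mono[rotated]) simp
    ultimately show False using xs(1) l(1) by simp
  qed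
  ultimately obtain x where "filling n k d x" "f_op l x = Some y"
    using f_op_preimage_exists[OF fy l(1,2) p(1)] by blast
  then show ?thesis using that[OF l(1,2)] semistandard_f_op_inverse[OF _ y l(1,2)] by blast
qed

text \<open>
  The element \<open>r\<^sub>\<lambda>\<close>, given by the superscripts of its components.
\<close>

definition highest :: "nat \<Rightarrow> (nat \<Rightarrow> nat) \<Rightarrow> nat \<Rightarrow> rseq option" where
  "highest k d = (\<lambda>q. if q < k then Some (d q, []) else None)"

lemma semistandard_highest:
  assumes "\<And>q. Suc q < k \<Longrightarrow> d q \<le> d (Suc q)"
  shows "semistandard n k d (highest k d)"
proof -
  have R: "(i, []) \<in> R n i 0" for i by (simp add: R_def)
  have "filling n k d (highest k d)" using R unfolding filling_def highest_def by fastforce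
  then show ?thesis unfolding semistandard_def
    using count_full_column[OF R] assms by (auto simp: highest_def)
qed

text \<open>
  Every semistandard element can be raised to \<open>r\<^sub>\<lambda>\<close>, because each raising step decreases the sum
  of all column entries by one.
\<close>

lemma semistandard_connected:
  assumes d: "\<And>q. q < k \<Longrightarrow> d q \<in> {1..n}" and x: "semistandard n k d x"
  shows "(highest k d, x) \<in> (arrows n \<union> (arrows n)\<inverse>)\<^sup>*"
  using x
proof (induction "\<Sum>q<k. \<Sum>(column (the (x q)))" arbitrary: x rule: less_induct)
  case less
  show ?case
  proof (cases "\<exists>q<k. x q \<noteq> Some (d q, [])")
    case False
    moreover have "x q = None" if "k \<le> q" for q
      using less.prems that by (simp add: semistandard_def filling_def)
    ultimately have "x = highest k d" by (auto simp: highest_def fun_eq_iff)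
    then show ?thesis by simp
  next
    case True
    then obtain l y where l: "1 \<le> l" "l \<le> n" and y: "semistandard n k d y" "f_op l y = Some x"
      using semistandard_raise[OF less.prems] by blast
    have fy: "filling n k d y" using y(1) by (simp add: semistandard_def)
    obtain q z where q: "q < k" "x = y(q := Some z)" "l \<in> column (the (y q))"
      "Suc l \<notin> column (the (y q))" "column z = lower l (column (the (y q)))"
      by (rule f_op_filling[OF fy l y(2)])
    have "(\<Sum>r<k. \<Sum>(column (the (y r)))) < (\<Sum>r<k. \<Sum>(column (the (x r))))"
    proof (rule sum_strict_mono_ex1)
      show "\<exists>r\<in>{..<k}. \<Sum>(column (the (y r))) < \<Sum>(column (the (x r)))"
        using q sum_lower[OF finite_column q(3,4)] by (intro bexI[of _ q]) auto
      show "\<forall>r\<in>{..<k}. \<Sum>(column (the (y r))) \<le> \<Sum>(column (the (x r)))"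
        using q sum_lower[OF finite_column q(3,4)] by auto
    qed simp
    then have "(highest k d, y) \<in> (arrows n \<union> (arrows n)\<inverse>)\<^sup>*" using less.hyps y(1) by blast
    moreover have "(y, x) \<in> arrows n"
      using filling_R_inf[OF fy d] l y(2) unfolding arrows_def by auto
    ultimately show ?thesis by (meson UnI1 rtrancl.rtrancl_into_rtrancl)
  qed
qed

lemma component_highest:
  assumes d: "\<And>q. q < k \<Longrightarrow> d q \<in> {1..n}" and mono: "\<And>q. Suc q < k \<Longrightarrow> d q \<le> d (Suc q)"
  shows "{x. (highest k d, x) \<in> (arrows n \<union> (arrows n)\<inverse>)\<^sup>*} = {x. semistandard n k d x}"
proof -
  have "semistandard n k d x" if "(highest k d, x) \<in> (arrows n \<union> (arrows n)\<inverse>)\<^sup>*" for x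
    using that
  proof (induction rule: rtrancl_induct)
    case base
    show ?case by (rule semistandard_highest) (rule mono)
  next
    case (step y z)
    from step.hyps(2) show ?case
    proof
      assume "(y, z) \<in> arrows n"
      then obtain l where "1 \<le> l" "l \<le> n" "f_op l y = Some z" by (auto simp: arrows_def)
      then show ?thesis using semistandard_f_op[OF step.IH] by blast
    next
      assume "(y, z) \<in> (arrows n)\<inverse>"
      then obtain l where l: "z \<in> R_inf n" "1 \<le> l" "l \<le> n" "f_op l z = Some y"
        by (auto simp: arrows_def)
      have "filling n k d y" using step.IH by (simp add: semistandard_def)
      from f_op_preimage_filling[OF l(1) this l(2-)]
      show ?thesis using semistandard_f_op_inverse[OF _ step.IH l(2-)] by blast
    qed
  qed
  then show ?thesis using semistandard_connected[of k d n, OF d] by blast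
qed

section \<open>The component of the highest weight element\<close>

lemma r_weight_facts:
  obtains es where "r_weight n m = (\<lambda>q. if q < length es then Some (es ! q) else None)"
    "length es = (\<Sum>i = 1..n. m i)" "sorted (map fst es)"
proof -
  define es where "es = concat (map (\<lambda>i. replicate (m i) (i, []::(nat \<times> nat) list)) [1..<n + 1])"
  have "sorted (map fst (concat (map (\<lambda>i. replicate (m i) (i, []::(nat \<times> nat) list)) is)))"
    if "sorted is" for "is"
    using that by (induction "is") (auto simp: sorted_append)
  then have "sorted (map fst es)" unfolding es_def by (metis sorted_upt)
  moreover have "length es = sum_list (map m [1..<n + 1])"
    by (simp add: es_def length_concat comp_def)
  moreover have "sum_list (map m [1..<n + 1]) = (\<Sum>i = 1..n. m i)"
    by (simp only: sum_set_upt_conv_sum_list_nat[symmetric] set_upt)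
       (simp only: Suc_eq_plus1[symmetric] atLeastLessThanSuc_atLeastAtMost)
  moreover have "r_weight n m = (\<lambda>q. if q < length es then Some (es ! q) else None)"
    unfolding r_weight_def es_def Let_def ..
  ultimately show ?thesis using that[of es] by metis
qed

text \<open>
  Neighbouring components satisfy the two conditions of the theorem exactly if their columns are
  comparable. If the second sequence is empty, there is no condition, since the column \<open>{1..j}\<close>
  has the largest counting function.
\<close>

lemma adjacent_iff:
  assumes x: "(i, xs) \<in> R n i s" and y: "(j, ys) \<in> R n j t" and ij: "i \<le> j"
  shows "(\<forall>v. count (column (i, xs)) v \<le> count (column (j, ys)) v) \<longleftrightarrow>
    (xs \<noteq> [] \<and> ys \<noteq> [] \<longrightarrow>
       cond_i (i, xs) (j, ys) \<and> cond_ii (i, xs) (j, ys) \<and> cond_iii (i, xs) (j, ys)) \<and>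
    (xs = [] \<and> ys \<noteq> [] \<longrightarrow> \<not> lo ys (int (length ys)) \<le> int i)"
proof -
  consider "ys = []" | "xs = []" "ys \<noteq> []" | "xs \<noteq> []" "ys \<noteq> []" by blast
  then show ?thesis
  proof cases
    case 1
    then show ?thesis using count_full_column[OF x ij] by simp
  next
    case 2
    have "0 < t" using R_D(2)[OF y] 2 by auto
    then have "lo ys (int (length ys)) \<le> int i \<longleftrightarrow> 0 < lows (j, ys) i"
      using lo_le_iff[OF y, of 0 i] R_D(2)[OF y] by simp
    also have "\<dots> \<longleftrightarrow> {a \<in> fst ` set ys. a \<le> i} \<noteq> {}"
      unfolding lows_def snd_conv by (subst card_gt_0_iff) simp
    finally have "lo ys (int (length ys)) \<le> int i \<longleftrightarrow> \<not> (\<forall>a\<in>fst ` set ys. i < a)"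
      by (auto simp: not_less)
    then show ?thesis using count_empty_column[OF y ij] 2 by simp
  next
    case 3
    then show ?thesis using conditions_iff[OF x y ij] by simp
  qed
qed

theorem theorem5p1p1:
  fixes n k :: nat and m d :: "nat \<Rightarrow> nat"
  assumes "n \<ge> 1"
    and "k = (\<Sum>i = 1..n. m i)"
    and "\<And>q. q < k \<Longrightarrow> d q \<in> {1..n} \<and> r_weight n m q = Some (d q, [])"
  shows "R_crystal n m =
    {x. (\<forall>q<k. \<exists>s. \<exists>y \<in> R n (d q) s. x q = Some y)
      \<and> (\<forall>q\<ge>k. x q = None)
      \<and> (\<forall>q i xs j ys. q + 1 < k \<and> x q = Some (i, xs) \<and> x (q + 1) = Some (j, ys)
            \<and> xs \<noteq> [] \<and> ys \<noteq> [] \<longrightarrow>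
           cond_i (i, xs) (j, ys) \<and> cond_ii (i, xs) (j, ys) \<and> cond_iii (i, xs) (j, ys))
      \<and> \<not> (\<exists>q i j ys. q + 1 < k \<and> x q = Some (i, []) \<and> x (q + 1) = Some (j, ys)
            \<and> ys \<noteq> [] \<and> int i \<ge> lo ys (int (length ys)))}"
proof -
  obtain es where es: "r_weight n m = (\<lambda>q. if q < length es then Some (es ! q) else None)"
    "length es = k" "sorted (map fst es)"
    using r_weight_facts[of n m] assms(2) by metis
  have nth: "es ! q = (d q, [])" if "q < k" for q using assms(3)[OF that] that es by simp
  have d: "d q \<in> {1..n}" if "q < k" for q using assms(3)[OF that] by simp
  have mono: "d q \<le> d (Suc q)" if "Suc q < k" for q
    using sorted_nth_mono[OF es(3), of q "Suc q"] that es(2) nth[of q] nth[of "Suc q"] by simp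
  have "r_weight n m = highest k d"
    unfolding es(1) highest_def es(2) using nth by (auto simp: fun_eq_iff)
  then have "R_crystal n m = {x. semistandard n k d x}"
    unfolding R_crystal_def using component_highest[of k d n, OF d mono] by simp
  also have "\<dots> = {x. (\<forall>q<k. \<exists>s. \<exists>y \<in> R n (d q) s. x q = Some y)
      \<and> (\<forall>q\<ge>k. x q = None)
      \<and> (\<forall>q i xs j ys. q + 1 < k \<and> x q = Some (i, xs) \<and> x (q + 1) = Some (j, ys)
            \<and> xs \<noteq> [] \<and> ys \<noteq> [] \<longrightarrow>
           cond_i (i, xs) (j, ys) \<and> cond_ii (i, xs) (j, ys) \<and> cond_iii (i, xs) (j, ys))
      \<and> \<not> (\<exists>q i j ys. q + 1 < k \<and> x q = Some (i, []) \<and> x (q + 1) = Some (j, ys)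
            \<and> ys \<noteq> [] \<and> int i \<ge> lo ys (int (length ys)))}" (is "_ = {x. ?F x \<and> ?N x \<and> ?C x \<and> ?E x}")
  proof (rule Collect_cong)
    fix x
    show "semistandard n k d x \<longleftrightarrow> ?F x \<and> ?N x \<and> ?C x \<and> ?E x"
    proof (cases "filling n k d x")
      case False
      then show ?thesis unfolding semistandard_def filling_def by blast
    next
      case True
      let ?good = "\<lambda>i xs j ys. (xs \<noteq> [] \<and> ys \<noteq> [] \<longrightarrow>
         cond_i (i, xs) (j, ys) \<and> cond_ii (i, xs) (j, ys) \<and> cond_iii (i, xs) (j, ys)) \<and>
         (xs = [] \<and> ys \<noteq> [] \<longrightarrow> \<not> lo ys (int (length ys)) \<le> int i)"
      have pair: "\<exists>xs ys. x q = Some (d q, xs) \<and> x (Suc q) = Some (d (Suc q), ys) \<and>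
          ((\<forall>v. count (column (the (x q))) v \<le> count (column (the (x (Suc q)))) v)
             \<longleftrightarrow> ?good (d q) xs (d (Suc q)) ys)" if q: "Suc q < k" for q
      proof -
        obtain s xs where xs: "x q = Some (d q, xs)" "(d q, xs) \<in> R n (d q) s"
          using True Suc_lessD[OF q] unfolding filling_def by (auto simp: R_def)
        obtain t ys where ys: "x (Suc q) = Some (d (Suc q), ys)" "(d (Suc q), ys) \<in> R n (d (Suc q)) t"
          using True q unfolding filling_def by (auto simp: R_def)
        show ?thesis using adjacent_iff[OF xs(2) ys(2) mono[OF q]] xs(1) ys(1) by simp
      qed
      have "semistandard n k d x \<longleftrightarrow> (\<forall>q. Suc q < k \<longrightarrow>
          (\<forall>v. count (column (the (x q))) v \<le> count (column (the (x (Suc q)))) v))"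
        using True by (auto simp: semistandard_def)
      also have "\<dots> \<longleftrightarrow> (\<forall>q i xs j ys. Suc q < k \<and> x q = Some (i, xs) \<and> x (Suc q) = Some (j, ys)
          \<longrightarrow> ?good i xs j ys)"
        using pair by (smt (verit) option.inject prod.inject)
      also have "\<dots> \<longleftrightarrow> ?C x \<and> ?E x" unfolding Suc_eq_plus1 by blast
      finally show ?thesis using True by (simp add: filling_def)
    qed
  qed
  finally show ?thesis .
qed

end
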